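(* Assume that the following statement holds: there exist universal constants $C,c,c'>0$ such that for every $n\ge2$ and every measurable subset $A\subseteq S^{n-1}$ with $\sigma_{n-1}(A)\geq e^{-c\sqrt{n}}$, $$\mathbb{P}_{H}\left(\sqrt{\sigma_H(A\cap H)\,\sigma_{H^{\perp}}(A\cap H^{\perp})}\geq 0.9\,\sigma_{n-1}(A)\right) \geq 1-Ce^{-c'\sqrt{n}}.$$ Then for every constant $0<\varepsilon<\frac12$ there exist $\kappa>0$ and $n_0$ such that for every $n\ge n_0$, every classical protocol $\mathcal{P}$ for the Vector in Subspace Problem in $\mathbb{R}^n$ whose probability of error is at most $\varepsilon$ has communication complexity at least $\kappa\sqrt{n}$ bits (i.e. the communication complexity of $\mathcal{P}$ is $\Omega(\sqrt{n})$).
   Context: $\sigma_{n-1}$ is the uniform probability measure on the unit sphere $S^{n-1}\subseteq\mathbb{R}^n$; for a subspace $H\subseteq\mathbb{R}^n$, $\sigma_H$ is the Haar (rotation-invariant) probability measure on $S^{n-1}\cap H$; $\mathbb{P}_H$ is probability with respect to a random subspace $H\subseteq\mathbb{R}^n$ of dimension $\lfloor n/2\rfloor$ distributed according to the orthogonally invariant Haar probability measure on the Grassmannian. Vector in Subspace Problem (VSP): Alice receives a unit vector $u\in S^{n-1}$, Bob receives a linear subspace $H\subseteq\mathbb{R}^n$ of dimension $\lfloor n/2\rfloor$, with the promise that either $u\in H$ or $u\in H^\perp$. They must determine which of the two holds. A deterministic (two-way) protocol is a finite binary tree. Each internal node is owned by Alice or by Bob. At a node owned by Alice the next bit sent is a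 measurable function of $u$ (the function being attached to the node, i.e. determined by the communication so far), and at a node owned by Bob it is a measurable function of $H$; the bit determines the child to move to. Each leaf is labeled with an answer, "$u\in H$" or "$u\in H^\perp$". The communication complexity is the number of bits exchanged in the worst case (the depth of the tree). A (randomized) protocol is a probability distribution over deterministic protocols; its communication complexity is the maximal communication complexity of the deterministic protocols used. Its probability of error is at most $\varepsilon$ if for every input $(u,H)$ satisfying the promise the answer is wrong with probability at most $\varepsilon$. *)

theory Defs
  imports "HOL-Probability.Probability"
begin

text \<open>
  The dimension \<open>n\<close> is quantified inside the formulas, so \<open>\<real>\<^sup>n\<close> cannot be a type. All the spaces
  \<open>\<real>\<^sup>n\<close> live in the inner product space of finitely supported real sequences, \<open>\<real>\<^sup>n\<close> being the
  subspace of the sequences that vanish from index \<open>n\<close> on. The type is made an instance of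
  \<open>real_inner\<close>, so that \<open>subspace\<close>, \<open>dim\<close>, \<open>sphere\<close>, \<open>borel\<close> and
  \<open>orthogonal_transformation\<close> are those of the library. On each \<open>\<real>\<^sup>n\<close> the
  inner product, norm and topology are the standard Euclidean ones.
\<close>

typedef fvec = "{f :: nat \<Rightarrow> real. finite {i. f i \<noteq> 0}}"
  morphisms coord Abs_fvec
  by (rule exI[of _ "\<lambda>_. 0"]) simp

setup_lifting type_definition_fvec

lemma finite_coord: "finite {i. coord x i \<noteq> 0}"
  using coord[of x] by simp

lemma fvec_eqI: "(\<And>i. coord x i = coord y i) \<Longrightarrow> x = y"
  by (metis coord_inject ext)

instantiation fvec :: real_vector
begin

lift_definition zero_fvec :: fvec is "\<lambda>_. 0" by simp

lift_definition plus_fvec :: "fvec \<Rightarrow> fvec \<Rightarrow> fvec" is "\<lambda>f g i. f i + g i"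
  subgoal for f g
    by (rule finite_subset[of _ "{i. f i \<noteq> 0} \<union> {i. g i \<noteq> 0}"]) auto
  done

lift_definition minus_fvec :: "fvec \<Rightarrow> fvec \<Rightarrow> fvec" is "\<lambda>f g i. f i - g i"
  subgoal for f g
    by (rule finite_subset[of _ "{i. f i \<noteq> 0} \<union> {i. g i \<noteq> 0}"]) auto
  done

lift_definition uminus_fvec :: "fvec \<Rightarrow> fvec" is "\<lambda>f i. - f i" by simp

lift_definition scaleR_fvec :: "real \<Rightarrow> fvec \<Rightarrow> fvec" is "\<lambda>c f i. c * f i"
  by (erule finite_subset[rotated]) auto

instance
  by standard (transfer; auto simp: algebra_simps)+

end

lemma coord_simps [simp]:
  "coord 0 i = 0"
  "coord (x + y) i = coord x i + coord y i"
  "coord (x - y) i = coord x i - coord y i"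
  "coord (- x) i = - coord x i"
  "coord (c *\<^sub>R x) i = c * coord x i"
  by (simp_all add: zero_fvec.rep_eq plus_fvec.rep_eq minus_fvec.rep_eq uminus_fvec.rep_eq
      scaleR_fvec.rep_eq)

instantiation fvec :: real_inner
begin

definition inner_fvec :: "fvec \<Rightarrow> fvec \<Rightarrow> real" where
  "inner_fvec x y = (\<Sum>i | coord x i \<noteq> 0. coord x i * coord y i)"

definition norm_fvec :: "fvec \<Rightarrow> real" where
  "norm_fvec x = sqrt (inner x x)"

definition sgn_fvec :: "fvec \<Rightarrow> fvec" where
  "sgn_fvec x = x /\<^sub>R norm x"

definition dist_fvec :: "fvec \<Rightarrow> fvec \<Rightarrow> real" where
  "dist_fvec x y = norm (x - y)"

definition uniformity_fvec :: "(fvec \<times> fvec) filter" where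
  "uniformity_fvec = (INF e\<in>{0<..}. principal {(x, y). dist x y < e})"

definition open_fvec :: "fvec set \<Rightarrow> bool" where
  "open_fvec U \<longleftrightarrow> (\<forall>x\<in>U. eventually (\<lambda>(x', y). x' = x \<longrightarrow> y \<in> U) uniformity)"

lemma inner_fvec_superset:
  assumes "finite I" "{i. coord x i \<noteq> 0} \<subseteq> I"
  shows "inner x y = (\<Sum>i\<in>I. coord x i * coord y i)"
  unfolding inner_fvec_def using assms by (intro sum.mono_neutral_left) auto

instance
proof
  fix x y z :: fvec and r :: real
  let ?I = "{i. coord x i \<noteq> 0} \<union> {i. coord y i \<noteq> 0}"
  have fin: "finite ?I" by (simp add: finite_coord)
  have 1: "inner w v = (\<Sum>i\<in>?I. coord w i * coord v i)"
    if "w \<in> {x, y, x + y, r *\<^sub>R x}" for w v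
    by (rule inner_fvec_superset[OF fin]) (use that in auto)
  show "inner x y = inner y x"
    by (simp add: 1 mult.commute)
  show "inner (x + y) z = inner x z + inner y z"
    by (simp add: 1 sum.distrib algebra_simps)
  show "inner (r *\<^sub>R x) y = r * inner x y"
    by (simp add: 1 sum_distrib_left algebra_simps)
  show "0 \<le> inner x x"
    unfolding inner_fvec_def by (intro sum_nonneg) auto
  show "inner x x = 0 \<longleftrightarrow> x = 0"
    by (auto simp: inner_fvec_def sum_nonneg_eq_0_iff finite_coord intro: fvec_eqI)
qed (simp_all add: norm_fvec_def sgn_fvec_def dist_fvec_def uniformity_fvec_def open_fvec_def)

end

lift_definition unit_fvec :: "nat \<Rightarrow> fvec" is "\<lambda>i j. if j = i then 1 else 0"
  by simp

definition Rn :: "nat \<Rightarrow> fvec set" where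
  "Rn n = {x. \<forall>i\<ge>n. coord x i = 0}"

definition usphere :: "fvec set \<Rightarrow> fvec set" where
  "usphere H = sphere 0 1 \<inter> H"

definition perp :: "nat \<Rightarrow> fvec set \<Rightarrow> fvec set" where
  "perp n H = {x \<in> Rn n. \<forall>y\<in>H. orthogonal x y}"

definition usphere_borel :: "fvec set \<Rightarrow> fvec measure" where
  "usphere_borel H = restrict_space borel (usphere H)"

text \<open>
  \<open>haar_usphere H \<mu>\<close> and \<open>haar_Gr n k \<gamma>\<close> (below) say that \<open>\<mu>\<close>, \<open>\<gamma>\<close> are the Haar probability
  measures on the unit sphere of \<open>H\<close> and on the Grassmannian. These exist and are unique when
  \<open>H \<noteq> {0}\<close> is a subspace of some \<open>\<real>\<^sup>n\<close>, respectively when \<open>k \<le> n\<close>.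
  Invariance is under the full orthogonal group of \<open>H\<close>, since for \<open>dim H = 1\<close> the special orthogonal
  group is trivial. Every orthogonal map of a finite-dimensional \<open>H\<close> is the restriction of an
  orthogonal transformation of the ambient space (extend it by the identity on the complement).
\<close>

definition haar_usphere :: "fvec set \<Rightarrow> fvec measure \<Rightarrow> bool" where
  "haar_usphere H \<mu> \<longleftrightarrow>
     prob_space \<mu> \<and> sets \<mu> = sets (usphere_borel H) \<and>
     (\<forall>T. orthogonal_transformation T \<and> T ` H = H \<longrightarrow> distr \<mu> \<mu> T = \<mu>)"

definition Gr :: "nat \<Rightarrow> nat \<Rightarrow> fvec set set" where
  "Gr n k = {H. subspace H \<and> H \<subseteq> Rn n \<and> dim H = k}"

definition orth_proj :: "fvec set \<Rightarrow> fvec \<Rightarrow> fvec" where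
  "orth_proj H x = (THE y. y \<in> H \<and> (\<forall>z\<in>H. orthogonal (x - y) z))"

text \<open>
  The topology of the Grassmannian is the one induced by the embedding that sends \<open>H\<close> to the matrix
  of the orthogonal projection onto \<open>H\<close>; its Borel sets are the preimages of Borel sets of matrices
  (all matrix entries outside the leading \<open>n \<times> n\<close> block are \<open>0\<close>).
\<close>

definition Gr_borel :: "nat \<Rightarrow> nat \<Rightarrow> fvec set measure" where
  "Gr_borel n k = vimage_algebra (Gr n k)
     (\<lambda>H (i, j). coord (orth_proj H (unit_fvec i)) j) (borel :: (nat \<times> nat \<Rightarrow> real) measure)"

definition haar_Gr :: "nat \<Rightarrow> nat \<Rightarrow> fvec set measure \<Rightarrow> bool" where
  "haar_Gr n k \<gamma> \<longleftrightarrow>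
     prob_space \<gamma> \<and> sets \<gamma> = sets (Gr_borel n k) \<and>
     (\<forall>T. orthogonal_transformation T \<and> T ` Rn n = Rn n \<longrightarrow> distr \<gamma> \<gamma> ((`) T) = \<gamma>)"

text \<open>
  Deterministic protocols. A bit \<open>True\<close> moves to the first subtree; the leaf label \<open>True\<close> is the
  answer \<open>u \<in> H\<close> and \<open>False\<close> is the answer \<open>u \<in> H\<^sup>\<bottom>\<close>.
\<close>

datatype protocol =
    Answer bool
  | Alice "fvec \<Rightarrow> bool" protocol protocol
  | Bob "fvec set \<Rightarrow> bool" protocol protocol

primrec run :: "protocol \<Rightarrow> fvec \<Rightarrow> fvec set \<Rightarrow> bool" where
  "run (Answer b) u H = b"
| "run (Alice f p q) u H = (if f u then run p u H else run q u H)"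
| "run (Bob g p q) u H = (if g H then run p u H else run q u H)"

primrec depth :: "protocol \<Rightarrow> nat" where
  "depth (Answer b) = 0"
| "depth (Alice f p q) = Suc (max (depth p) (depth q))"
| "depth (Bob g p q) = Suc (max (depth p) (depth q))"

primrec det_protocol :: "nat \<Rightarrow> protocol \<Rightarrow> bool" where
  "det_protocol n (Answer b) \<longleftrightarrow> True"
| "det_protocol n (Alice f p q) \<longleftrightarrow>
     f \<in> measurable (usphere_borel (Rn n)) (count_space UNIV) \<and> det_protocol n p \<and> det_protocol n q"
| "det_protocol n (Bob g p q) \<longleftrightarrow>
     g \<in> measurable (Gr_borel n (n div 2)) (count_space UNIV) \<and> det_protocol n p \<and> det_protocol n q"

text \<open>
  A randomized protocol is a probability measure \<open>P\<close> on a set \<open>space P\<close> of deterministic protocols.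
  There is no canonical \<open>\<sigma>\<close>-algebra on protocols. Any one is allowed for which the answer is a
  jointly measurable function of the protocol and the input, so that error probabilities and
  their averages over inputs are defined.
\<close>

definition rand_protocol :: "nat \<Rightarrow> protocol measure \<Rightarrow> bool" where
  "rand_protocol n P \<longleftrightarrow>
     prob_space P \<and> (\<forall>p\<in>space P. det_protocol n p) \<and>
     (\<lambda>(p, u, H). run p u H) \<in>
       measurable (P \<Otimes>\<^sub>M (usphere_borel (Rn n) \<Otimes>\<^sub>M Gr_borel n (n div 2))) (count_space UNIV)"

definition VSP_promise :: "nat \<Rightarrow> fvec \<Rightarrow> fvec set \<Rightarrow> bool" where
  "VSP_promise n u H \<longleftrightarrow>
     u \<in> usphere (Rn n) \<and> H \<in> Gr n (n div 2) \<and> (u \<in> H \<or> u \<in> perp n H)"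

definition error_at_most :: "nat \<Rightarrow> protocol measure \<Rightarrow> real \<Rightarrow> bool" where
  "error_at_most n P \<epsilon> \<longleftrightarrow>
     (\<forall>u H. VSP_promise n u H \<longrightarrow> measure P {p \<in> space P. run p u H \<noteq> (u \<in> H)} \<le> \<epsilon>)"

text \<open>The value is \<open>\<infinity>\<close> if the depths of the protocols used are unbounded.\<close>

definition comm_complexity :: "protocol measure \<Rightarrow> ereal" where
  "comm_complexity P = (SUP p\<in>space P. ereal (real (depth p)))"

end

theory Submission
  imports Defs
begin

text \<open>
  Majority voting over a constant number \<open>k\<close> of independent runs makes the error small at the price
  of a factor \<open>k\<close> in the depth. A deterministic protocol of depth \<open>D\<close> cuts Alice's sphere into at
  most \<open>2\<^sup>D\<close> leaf sets. For all \<open>H\<close> outside a set of measure \<open>2\<^sup>D C exp (- c' \<surd>n)\<close> the sampling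
  hypothesis applies to every leaf set that is not tiny, so the distributions of the leaf under
  \<open>u \<sim> \<sigma>\<^sub>H\<close> and under \<open>u\<close> uniform on the sphere of \<open>H\<^sup>\<bottom>\<close> have affinity almost \<open>0.9\<close>, and the two error
  probabilities of the protocol cannot both be small. Averaging over \<open>H\<close> and over the protocols
  contradicts the small error of the majority protocol if \<open>D\<close> is a small multiple of \<open>\<surd>n\<close>.

  Exchanging the two averages requires \<open>H \<mapsto> \<sigma>\<^sub>H\<close> to be measurable, although \<open>\<sigma>\<^sub>H\<close> is only known to
  be some rotation invariant measure for each \<open>H\<close>. Uniqueness of the invariant measure identifies
  it with the law of a normalised projection, which depends measurably on \<open>H\<close>.
\<close>

section \<open>Finitely supported sequences and orthogonal projections\<close>

lemma coord_sum [simp]: "coord (sum f I) i = (\<Sum>j\<in>I. coord (f j) i)"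
  by (induction I rule: infinite_finite_induct) auto

lemma coord_unit_fvec: "coord (unit_fvec i) j = (if j = i then 1 else 0)"
  by (simp add: unit_fvec.rep_eq)

lemma inner_unit_fvec: "inner (unit_fvec i) x = coord x i"
  by (subst inner_fvec_superset[of "{i}"]) (auto simp: coord_unit_fvec)

lemma norm_unit_fvec [simp]: "norm (unit_fvec i) = 1"
  by (simp add: norm_eq_sqrt_inner inner_unit_fvec coord_unit_fvec)

lemma Rn_expansion: "x \<in> Rn n \<Longrightarrow> x = (\<Sum>i<n. coord x i *\<^sub>R unit_fvec i)"
  by (rule fvec_eqI) (auto simp: coord_unit_fvec Rn_def if_distrib cong: if_cong)

lemma subspace_Rn: "subspace (Rn n)"
  by (auto simp: subspace_def Rn_def)

lemma Rn_exhausts: obtains n where "x \<in> Rn n"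
proof -
  obtain n where "\<forall>i\<in>{i. coord x i \<noteq> 0}. i < n"
    using finite_coord[of x] finite_nat_set_iff_bounded by blast
  then have "x \<in> Rn n" by (force simp: Rn_def)
  then show ?thesis by (rule that)
qed

lemma unit_fvec_in_Rn: "i < n \<Longrightarrow> unit_fvec i \<in> Rn n"
  by (auto simp: Rn_def coord_unit_fvec)

lemma span_unit_fvec: "span (unit_fvec ` {..<n}) = Rn n"
proof
  show "span (unit_fvec ` {..<n}) \<subseteq> Rn n"
    by (rule span_minimal) (auto simp: unit_fvec_in_Rn subspace_Rn)
  show "Rn n \<subseteq> span (unit_fvec ` {..<n})"
  proof
    fix x assume "x \<in> Rn n"
    then have "x = (\<Sum>i<n. coord x i *\<^sub>R unit_fvec i)" by (rule Rn_expansion)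
    also have "\<dots> \<in> span (unit_fvec ` {..<n})"
      by (intro span_sum span_scale span_base) auto
    finally show "x \<in> span (unit_fvec ` {..<n})" .
  qed
qed

lemma inj_unit_fvec: "inj unit_fvec"
  by (rule injI) (metis coord_unit_fvec zero_neq_one)

lemma dim_Rn: "dim (Rn n) = n"
proof (rule dim_unique[of "unit_fvec ` {..<n}"])
  show "independent (unit_fvec ` {..<n})"
  proof (rule pairwise_orthogonal_independent)
    show "pairwise orthogonal (unit_fvec ` {..<n})"
      by (auto simp: pairwise_def orthogonal_def inner_unit_fvec coord_unit_fvec)
    show "0 \<notin> unit_fvec ` {..<n}"
      by (metis imageE norm_unit_fvec norm_zero zero_neq_one)
  qed
  show "card (unit_fvec ` {..<n}) = n"
    by (simp add: card_image inj_on_subset[OF inj_unit_fvec])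
qed (auto simp: unit_fvec_in_Rn span_unit_fvec)

section \<open>Separability of the ambient space\<close>

text \<open>Finite rational combinations of the unit vectors approximate every vector. This yields
  second countability, which makes the Borel sets of a product the product of the Borel sets and
  gives Lindelof covers; the uniqueness of measures below uses both.\<close>

lemma countable_dense_fvec: "\<exists>D :: fvec set. countable D \<and> (\<forall>x. \<forall>e>0. \<exists>y\<in>D. dist x y < e)"
proof (intro exI[of _ "range (\<lambda>qs :: rat list.
    \<Sum>i<length qs. of_rat (qs ! i) *\<^sub>R unit_fvec i)"] conjI allI impI)
  fix x :: fvec and e :: real assume e: "e > 0"
  obtain n where x: "x \<in> Rn n" by (rule Rn_exhausts)
  \<comment> \<open>Splitting \<open>e\<close> into n + 1 rather than n parts keeps the total
    strictly below \<open>e\<close> and the bound positive for n = 0.\<close>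
  have "\<exists>q. \<bar>coord x i - of_rat q\<bar> < e / (real n + 1)" for i
  proof -
    obtain q where "coord x i - e / (real n + 1) < of_rat q" "of_rat q < coord x i"
      using of_rat_dense[of "coord x i - e / (real n + 1)" "coord x i"] e by auto
    then show ?thesis by (intro exI[of _ q]) auto
  qed
  then obtain q where q: "\<And>i. \<bar>coord x i - of_rat (q i)\<bar> < e / (real n + 1)" by metis
  define qs where "qs = map q [0..<n]"
  have "dist x (\<Sum>i<length qs. of_rat (qs ! i) *\<^sub>R unit_fvec i)
      = norm (\<Sum>i<n. (coord x i - of_rat (q i)) *\<^sub>R unit_fvec i)"
    by (subst Rn_expansion[OF x]) (simp add: dist_norm qs_def scaleR_diff_left sum_subtractf)
  also have "\<dots> \<le> (\<Sum>i<n. \<bar>coord x i - of_rat (q i)\<bar>)"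
    by (rule sum_norm_le) simp
  also have "\<dots> \<le> (\<Sum>i<n. e / (real n + 1))"
    using q by (intro sum_mono less_imp_le) auto
  also have "\<dots> < e" using e by (simp add: field_simps)
  finally show "\<exists>y\<in>range (\<lambda>qs :: rat list.
    \<Sum>i<length qs. of_rat (qs ! i) *\<^sub>R unit_fvec i). dist x y < e" by blast
qed auto

instance fvec :: second_countable_topology
proof
  obtain D :: "fvec set" where D: "countable D" "\<And>x e. e > 0 \<Longrightarrow> \<exists>y\<in>D. dist x y < e"
    using countable_dense_fvec by metis
  let ?B = "(\<lambda>(d, k). ball d (1 / real (Suc k))) ` (D \<times> (UNIV :: nat set))"
  have "topological_basis ?B"
  proof (rule topological_basisI)
    fix U :: "fvec set" and x assume "open U" "x \<in> U"
    then obtain e where e: "e > 0" "ball x e \<subseteq> U" by (meson openE)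
    obtain k where k: "1 / real (Suc k) < e / 2"
      using e nat_approx_posE[of "e / 2"] by auto
    obtain d where d: "d \<in> D" "dist x d < 1 / real (Suc k)" using D(2)[of "1 / real (Suc k)" x] by auto
    have "ball d (1 / real (Suc k)) \<subseteq> ball x e"
    proof
      fix z assume "z \<in> ball d (1 / real (Suc k))"
      then show "z \<in> ball x e" using d k dist_triangle[of x z d] by simp
    qed
    then show "\<exists>V\<in>?B. x \<in> V \<and> V \<subseteq> U"
      using d e by (intro bexI[of _ "ball d (1 / real (Suc k))"]) (auto simp: dist_commute)
  qed auto
  moreover have "countable ?B" using D by auto
  ultimately show "\<exists>B :: fvec set set. countable B \<and> open = generate_topology B"
    using topological_basis_imp_subbasis by blast
qed

lemma continuous_on_coord: "continuous_on X (\<lambda>x. coord x i)"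
  unfolding inner_unit_fvec[symmetric] by (intro continuous_intros)

lemma measurable_coord [measurable]: "(\<lambda>x. coord x i) \<in> borel_measurable borel"
  by (intro borel_measurable_continuous_onI continuous_on_coord)

section \<open>Orthogonal projections and complements\<close>

text \<open>Gram-Schmidt by induction on \<open>B\<close>: \<open>w\<close> is the part of the new
  vector \<open>b\<close> orthogonal to the old span, and the component of \<open>x\<close> along
  \<open>w\<close> is added to the old projection. If \<open>w = 0\<close>, division by zero gives 0
  and nothing is added.\<close>

lemma orth_proj_exists_span:
  fixes x :: "'a :: real_inner"
  assumes "finite B"
  shows "\<exists>y\<in>span B. \<forall>z\<in>span B. orthogonal (x - y) z"
  using assms
proof (induction B arbitrary: x)
  case empty
  then show ?case by (auto simp: orthogonal_def)
next
  case (insert b B)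
  obtain c where c: "c \<in> span B" "\<And>z. z \<in> span B \<Longrightarrow> orthogonal (b - c) z"
    using insert.IH by blast
  obtain y where y: "y \<in> span B" "\<And>z. z \<in> span B \<Longrightarrow> orthogonal (x - y) z"
    using insert.IH by blast
  define w where "w = b - c"
  have bB: "b \<in> span (insert b B)" and B: "span B \<subseteq> span (insert b B)"
    by (auto intro: span_base span_mono[THEN subsetD])
  have w: "w \<in> span (insert b B)"
    unfolding w_def using c B bB by (auto intro: span_diff)
  define y' where "y' = y + (inner x w / inner w w) *\<^sub>R w"
  have y': "y' \<in> span (insert b B)"
    unfolding y'_def using y B w by (auto intro: span_add span_scale)
  have wB: "inner w z = 0" "inner z w = 0" if "z \<in> span B" for z
    using c(2)[OF that] by (auto simp: orthogonal_def w_def inner_commute)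
  have 1: "inner (x - y') w = 0"
    using wB[OF y(1)] by (cases "w = 0") (auto simp: y'_def inner_diff_left inner_add_left)
  have 2: "inner (x - y') z = 0" if "z \<in> span B" for z
    using wB[OF that] y(2)[OF that]
    by (auto simp: y'_def inner_diff_left inner_add_left orthogonal_def)
  have "inner (x - y') z = 0" if z: "z \<in> span (insert b B)" for z
  proof -
    obtain k where k: "z - k *\<^sub>R b \<in> span B" using z by (auto simp: span_insert)
    have "z = (z - k *\<^sub>R b) + k *\<^sub>R c + k *\<^sub>R w"
      by (simp add: w_def scaleR_diff_right)
    then have "inner (x - y') z = inner (x - y') (z - k *\<^sub>R b) + k * inner (x - y') c + k * inner (x - y') w"
      by (metis inner_add_right inner_scaleR_right)
    then show ?thesis using 1 2[OF k] 2[OF c(1)] by simp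
  qed
  then show ?case using y' by (auto simp: orthogonal_def)
qed

context
  fixes n :: nat and H :: "fvec set"
  assumes H: "subspace H" "H \<subseteq> Rn n"
begin

text \<open>The ambient space is not complete, so existence rests on a finite basis of
  \<open>H\<close> inside \<open>Rn n\<close>. Two candidates differ by a vector of \<open>H\<close>
  that is orthogonal to itself. This justifies the description operator in
  \<open>orth_proj\<close>.\<close>

lemma orth_proj_ex1: "\<exists>!y. y \<in> H \<and> (\<forall>z\<in>H. orthogonal (x - y) z)"
proof -
  obtain B where B: "B \<subseteq> H" "independent B" "H \<subseteq> span B"
    by (rule basis_exists[of H])
  have "finite B"
    using independent_span_bound[of "unit_fvec ` {..<n}" B] B H span_unit_fvec by auto
  moreover have "span B = H"
    using B H by (metis span_minimal subset_antisym)
  ultimately obtain y where y: "y \<in> H" "\<And>z. z \<in> H \<Longrightarrow> orthogonal (x - y) z"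
    using orth_proj_exists_span[of B x] by auto
  show ?thesis
  proof (rule ex1I[of _ y])
    fix v assume v: "v \<in> H \<and> (\<forall>z\<in>H. orthogonal (x - v) z)"
    have "v - y \<in> H" using v y H by (auto intro: subspace_diff)
    then have "inner (x - y) (v - y) = 0" "inner (x - v) (v - y) = 0"
      using v y by (auto simp: orthogonal_def)
    then have "inner (v - y) (v - y) = 0" by (simp add: inner_diff_left)
    then show "v = y" by simp
  qed (use y in auto)
qed

lemma orth_proj_in: "orth_proj H x \<in> H"
  and orth_proj_orthogonal: "z \<in> H \<Longrightarrow> inner (x - orth_proj H x) z = 0"
  using theI'[OF orth_proj_ex1[of x]] by (auto simp: orth_proj_def orthogonal_def)

lemma orth_proj_eqI: "y \<in> H \<Longrightarrow> (\<And>z. z \<in> H \<Longrightarrow> inner (x - y) z = 0) \<Longrightarrow> orth_proj H x = y"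
  using orth_proj_ex1[of x] orth_proj_in[of x] orth_proj_orthogonal[of _ x]
  by (auto simp: orthogonal_def)

lemma orth_proj_id: "x \<in> H \<Longrightarrow> orth_proj H x = x"
  by (rule orth_proj_eqI) auto

lemma linear_orth_proj: "linear (orth_proj H)"
proof
  fix x y r
  show "orth_proj H (x + y) = orth_proj H x + orth_proj H y"
    using orth_proj_in orth_proj_orthogonal[of _ x] orth_proj_orthogonal[of _ y]
    by (intro orth_proj_eqI subspace_add H) (auto simp: inner_diff_left inner_add_left)
  show "orth_proj H (r *\<^sub>R x) = r *\<^sub>R orth_proj H x"
    using orth_proj_in orth_proj_orthogonal[of _ x]
    by (intro orth_proj_eqI subspace_scale H) (auto simp: inner_diff_left)
qed

lemma inner_orth_proj: "z \<in> H \<Longrightarrow> inner (orth_proj H x) z = inner x z"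
  using orth_proj_orthogonal[of z x] by (simp add: inner_diff_left)

text \<open>\<open>H\<close> is an intersection of closed hyperplanes: a vector orthogonal to all
  residuals is orthogonal to its own residual, which must then vanish.\<close>

lemma closed_subspace_Rn: "closed H"
proof -
  have "H = (\<Inter>x. {y. inner (x - orth_proj H x) y = 0})"
  proof (intro equalityI subsetI)
    fix y assume "y \<in> (\<Inter>x. {y. inner (x - orth_proj H x) y = 0})"
    then have "inner (y - orth_proj H y) (y - orth_proj H y) = 0"
      using orth_proj_orthogonal[OF orth_proj_in, of y y] by (subst inner_diff_right) auto
    then show "y \<in> H" using orth_proj_in[of y] by simp
  qed (use orth_proj_orthogonal in auto)
  moreover have "closed (\<Inter>x. {y. inner (x - orth_proj H x) y = 0})"
    by (intro closed_INT ballI closed_hyperplane)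
  ultimately show ?thesis by simp
qed

lemma closed_usphere: "closed (usphere H)"
proof -
  have "closed {x :: fvec. norm x = 1}" by (intro closed_Collect_eq continuous_intros)
  moreover have "usphere H = {x. norm x = 1} \<inter> H" by (auto simp: usphere_def)
  ultimately show ?thesis using closed_subspace_Rn by (simp add: closed_Int)
qed

text \<open>The coefficients are the matrix entries that generate \<open>Gr_borel\<close>, so this
  finite sum makes the projection measurable in \<open>x\<close> and jointly in \<open>H\<close> and
  \<open>x\<close>.\<close>

lemma orth_proj_sum_unit:
  assumes "x \<in> Rn n"
  shows "orth_proj H x = (\<Sum>i<n. coord x i *\<^sub>R (\<Sum>j<n. coord (orth_proj H (unit_fvec i)) j *\<^sub>R unit_fvec j))"
proof -
  have "orth_proj H x = (\<Sum>i<n. coord x i *\<^sub>R orth_proj H (unit_fvec i))"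
    using arg_cong[OF Rn_expansion[OF assms], of "orth_proj H"]
    by (simp only: linear_sum[OF linear_orth_proj] linear_scale[OF linear_orth_proj])
  also have "\<dots> = (\<Sum>i<n. coord x i *\<^sub>R (\<Sum>j<n. coord (orth_proj H (unit_fvec i)) j *\<^sub>R unit_fvec j))"
    using orth_proj_in H(2) by (intro sum.cong refl arg_cong2[of _ _ _ _ scaleR] Rn_expansion) auto
  finally show ?thesis .
qed

lemma subspace_perp: "subspace (perp n H)"
  using subspace_Rn[of n] unfolding perp_def
  by (auto simp: subspace_def orthogonal_def inner_add_left)

lemma perp_subset: "perp n H \<subseteq> Rn n"
  by (auto simp: perp_def)

lemma diff_orth_proj_in_perp: "x \<in> Rn n \<Longrightarrow> x - orth_proj H x \<in> perp n H"
  using orth_proj_in[of x] orth_proj_orthogonal[of _ x] H(2) subspace_diff[OF subspace_Rn]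
  by (auto simp: perp_def orthogonal_def)

lemma perp_eq_zeroD: "perp n H = {0} \<Longrightarrow> H = Rn n"
proof (rule antisym)
  assume 0: "perp n H = {0}"
  show "Rn n \<subseteq> H"
  proof
    fix x assume "x \<in> Rn n"
    then have "orth_proj H x = x" using diff_orth_proj_in_perp[of x] 0 by simp
    then show "x \<in> H" using orth_proj_in[of x] by simp
  qed
qed (rule H)

end

lemma orth_proj_perp:
  assumes "subspace H" "H \<subseteq> Rn n" "x \<in> Rn n"
  shows "orth_proj (perp n H) x = x - orth_proj H x"
proof (rule orth_proj_eqI[OF subspace_perp[OF assms(1,2)] perp_subset[OF assms(1,2)]])
  show "x - orth_proj H x \<in> perp n H" by (rule diff_orth_proj_in_perp[OF assms])
  show "inner (x - (x - orth_proj H x)) z = 0" if "z \<in> perp n H" for z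
    using that orth_proj_in[OF assms(1,2), of x]
    by (simp add: perp_def orthogonal_def inner_commute[of "orth_proj H x"])
qed

section \<open>Uniqueness of uniformly distributed measures\<close>

text \<open>
  Christensen's argument: integrate the kernel \<open>dist x y < r\<close> over \<open>U \<times> U\<close>, normalise by the common
  measure of the balls of radius \<open>r\<close>, and let \<open>r \<rightarrow> 0\<close> with Fatou's lemma.
\<close>

lemma dist_less_in_sets_pair:
  "{(x, y). dist x y < r} \<in> sets (borel \<Otimes>\<^sub>M borel :: ('a :: {metric_space, second_countable_topology} \<times> 'a) measure)"
proof -
  have "open {p :: 'a \<times> 'a. dist (fst p) (snd p) < r}"
    by (intro open_Collect_less continuous_intros)
  moreover have "{(x, y). dist x y < r} = {p :: 'a \<times> 'a. dist (fst p) (snd p) < r}" by auto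
  ultimately show ?thesis by (metis borel_open borel_prod)
qed

text \<open>By Tonelli both sides measure, under the product of \<open>M\<close> and
  \<open>N\<close>, the pairs of \<open>U \<times> V\<close> at distance less than
  \<open>r\<close>.\<close>

lemma nn_integral_ball_swap:
  fixes M N :: "'a :: {metric_space, second_countable_topology} measure"
  assumes "prob_space M" "prob_space N" and [measurable_cong]: "sets M = sets borel" "sets N = sets borel"
  assumes [measurable]: "U \<in> sets borel" "V \<in> sets borel"
  shows "(\<integral>\<^sup>+x. indicator U x * emeasure N (V \<inter> ball x r) \<partial>M)
       = (\<integral>\<^sup>+y. indicator V y * emeasure M (U \<inter> ball y r) \<partial>N)"
proof -
  interpret M: prob_space M by fact
  interpret N: prob_space N by fact
  interpret pair_sigma_finite M N ..
  have *: "indicator (ball x r) y = (indicator {(x, y). dist x y < r} (x, y) :: ennreal)"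
    "indicator (ball y r) x = (indicator {(x, y). dist x y < r} (x, y) :: ennreal)" for x y :: 'a
    by (auto simp: indicator_def dist_commute)
  have [measurable]: "{(x, y). dist x y < r} \<in> sets (borel \<Otimes>\<^sub>M borel :: ('a \<times> 'a) measure)"
  by (rule dist_less_in_sets_pair)
  have "(\<integral>\<^sup>+x. indicator U x * emeasure N (V \<inter> ball x r) \<partial>M)
      = (\<integral>\<^sup>+x. \<integral>\<^sup>+y. indicator U x * (indicator V y * indicator {(x, y). dist x y < r} (x, y)) \<partial>N \<partial>M)"
    by (subst nn_integral_cmult, measurable)
      (simp add: *[symmetric] indicator_inter_arith[symmetric] nn_integral_indicator)
  also have "\<dots> = (\<integral>\<^sup>+y. \<integral>\<^sup>+x. indicator U x * (indicator V y * indicator {(x, y). dist x y < r} (x, y)) \<partial>M \<partial>N)"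
    by (rule Fubini'[symmetric]) measurable
  also have "\<dots> = (\<integral>\<^sup>+y. \<integral>\<^sup>+x. indicator V y * (indicator U x * indicator {(x, y). dist x y < r} (x, y)) \<partial>M \<partial>N)"
    by (simp add: ac_simps)
  also have "\<dots> = (\<integral>\<^sup>+y. indicator V y * emeasure M (U \<inter> ball y r) \<partial>N)"
    by (subst nn_integral_cmult, measurable)
      (simp add: *(2)[symmetric] indicator_inter_arith[symmetric] nn_integral_indicator)
  finally show ?thesis .
qed

lemma uniformly_distributed_le_open:
  fixes M N :: "'a :: {metric_space, second_countable_topology} measure"
  assumes pM: "prob_space M" and pN: "prob_space N"
    and s[measurable_cong]: "sets M = sets borel" "sets N = sets borel"
    and "AE x in M. x \<in> S" and AN: "AE x in N. x \<in> S"
    and M: "\<And>x r. x \<in> S \<Longrightarrow> r > 0 \<Longrightarrow> emeasure M (ball x r) = h r"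
    and N: "\<And>x r. x \<in> S \<Longrightarrow> r > 0 \<Longrightarrow> emeasure N (ball x r) = g r"
    and pos: "\<And>r. r > 0 \<Longrightarrow> h r > 0"
    and U: "open U"
  shows "emeasure M U \<le> emeasure N U"
proof -
  interpret M: prob_space M by fact
  interpret N: prob_space N by fact
  have [measurable]: "U \<in> sets borel" using U by simp
  \<comment> \<open>Swapping with both sets equal to the whole space integrates \<open>g r\<close>
    over \<open>M\<close> and \<open>h r\<close> over \<open>N\<close>, so the two ball measures
    agree.\<close>
  have gh: "g r = h r" if r: "r > 0" for r
  proof -
    have "g r = (\<integral>\<^sup>+x. g r \<partial>M)" by (simp add: M.emeasure_space_1)
    also have "\<dots> = (\<integral>\<^sup>+x. indicator UNIV x * emeasure N (UNIV \<inter> ball x r) \<partial>M)"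
      using assms(5) by (intro nn_integral_cong_AE) (auto simp: N r)
    also have "\<dots> = (\<integral>\<^sup>+y. indicator UNIV y * emeasure M (UNIV \<inter> ball y r) \<partial>N)"
      by (rule nn_integral_ball_swap) (fact | simp)+
    also have "\<dots> = (\<integral>\<^sup>+x. h r \<partial>N)"
      using AN by (intro nn_integral_cong_AE) (auto simp: M r)
    also have "\<dots> = h r" by (simp add: N.emeasure_space_1)
    finally show ?thesis .
  qed
  define r where "r k = 1 / real (Suc k)" for k
  have r: "r k > 0" for k by (simp add: r_def)
  have fin: "h (r k) \<noteq> \<infinity>" if "x \<in> S" for x k
    using M.emeasure_finite M[OF that r] by (metis infinity_ennreal_def)
  have [measurable]: "(\<lambda>x. emeasure N (U \<inter> ball x (r k))) \<in> borel_measurable M" for k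
  proof -
    have "{(x, y). dist x y < r k} \<in> sets (M \<Otimes>\<^sub>M N)"
      using dist_less_in_sets_pair[of "r k"] by (simp cong: sets_pair_measure_cong add: s)
    moreover have "UNIV \<times> U \<in> sets (M \<Otimes>\<^sub>M N)"
      using s by (intro pair_measureI) (auto)
    ultimately have "{(x, y). dist x y < r k} \<inter> UNIV \<times> U \<in> sets (M \<Otimes>\<^sub>M N)" by auto
    from N.measurable_emeasure_Pair[OF this] show ?thesis
      by (rule measurable_cong[THEN iffD1, rotated]) (auto intro!: arg_cong[of _ _ "emeasure N"])
  qed
  have AM: "AE x in M. x \<in> S" by fact
  have "emeasure M U = (\<integral>\<^sup>+x. indicator U x \<partial>M)" by simp
  also have "\<dots> \<le> (\<integral>\<^sup>+x. liminf (\<lambda>k. indicator U x * emeasure N (U \<inter> ball x (r k)) / h (r k)) \<partial>M)"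
  proof (rule nn_integral_mono_AE, use AM in eventually_elim)
    fix x assume x: "x \<in> S"
    show "indicator U x \<le> liminf (\<lambda>k. indicator U x * emeasure N (U \<inter> ball x (r k)) / h (r k))"
    proof (cases "x \<in> U")
      case True
      then obtain e where e: "e > 0" "ball x e \<subseteq> U" using U by (meson openE)
      have "eventually (\<lambda>k. r k < e) sequentially"
        using e(1) LIMSEQ_inverse_real_of_nat unfolding r_def inverse_eq_divide
        by (rule order_tendstoD(2)[rotated])
      \<comment> \<open>Once the ball of radius \<open>r k\<close> around \<open>x\<close> lies in
        \<open>U\<close>, the quotient is \<open>h (r k) / h (r k)\<close>; it is 1 because
        \<open>h (r k)\<close> is positive and finite.\<close>
      then have "eventually (\<lambda>k. 1 = indicator U x * emeasure N (U \<inter> ball x (r k)) / h (r k)) sequentially"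
      proof eventually_elim
        case (elim k)
        then have "U \<inter> ball x (r k) = ball x (r k)" using e by auto
        then show ?case using True N[OF x r] gh[OF r] fin[OF x] pos[OF r, of k]
          by (simp add: ennreal_divide_self top.not_eq_extremum)
      qed
      then have "eventually (\<lambda>k. 1 \<le> indicator U x * emeasure N (U \<inter> ball x (r k)) / h (r k)) sequentially"
        by eventually_elim simp
      then show ?thesis using True by (simp add: Liminf_bounded)
    qed auto
  qed
  also have "\<dots> \<le> liminf (\<lambda>k. \<integral>\<^sup>+x. indicator U x * emeasure N (U \<inter> ball x (r k)) / h (r k) \<partial>M)"
    by (rule nn_integral_liminf) measurable
  also have "\<dots> = liminf (\<lambda>k. (\<integral>\<^sup>+x. indicator U x * emeasure N (U \<inter> ball x (r k)) \<partial>M) / h (r k))"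
    by (subst nn_integral_divide) auto
  also have "\<dots> = liminf (\<lambda>k. (\<integral>\<^sup>+y. indicator U y * emeasure M (U \<inter> ball y (r k)) \<partial>N) / h (r k))"
    by (subst nn_integral_ball_swap[OF pM pN s]) auto
  also have "\<dots> \<le> liminf (\<lambda>k. emeasure N U)"
  proof (intro Liminf_mono always_eventually allI)
    \<comment> \<open>On \<open>U\<close> the integrand is at most the measure
      \<open>h (r k)\<close> of a full ball; this factor cancels and leaves the
      \<open>N\<close>-measure of \<open>U\<close>.\<close>
    fix k
    have "(\<integral>\<^sup>+y. indicator U y * emeasure M (U \<inter> ball y (r k)) \<partial>N) \<le> (\<integral>\<^sup>+y. h (r k) * indicator U y \<partial>N)"
    proof (rule nn_integral_mono_AE, use AN in eventually_elim)
      fix y assume "y \<in> S"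
      then have "emeasure M (U \<inter> ball y (r k)) \<le> h (r k)"
        unfolding M[OF \<open>y \<in> S\<close> r, symmetric] by (intro emeasure_mono) auto
      then show "indicator U y * emeasure M (U \<inter> ball y (r k)) \<le> h (r k) * indicator U y"
        by (auto simp: indicator_def)
    qed
    also have "\<dots> = h (r k) * emeasure N U" by (simp add: nn_integral_cmult_indicator)
    finally show "(\<integral>\<^sup>+y. indicator U y * emeasure M (U \<inter> ball y (r k)) \<partial>N) / h (r k) \<le> emeasure N U"
      using pos[OF r, of k] by (intro divide_le_posI_ennreal)
  qed
  also have "\<dots> = emeasure N U" by (simp add: Liminf_const)
  finally show ?thesis .
qed

text \<open>The comparison on open sets is applied in both directions, and open sets form an
  intersection-stable generator of the Borel sets.\<close>

lemma uniformly_distributed_unique: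
  fixes M N :: "'a :: {metric_space, second_countable_topology} measure"
  assumes pM: "prob_space M" and pN: "prob_space N"
    and s: "sets M = sets borel" "sets N = sets borel"
    and AE: "AE x in M. x \<in> S" "AE x in N. x \<in> S"
    and M: "\<And>x r. x \<in> S \<Longrightarrow> r > 0 \<Longrightarrow> emeasure M (ball x r) = h r"
    and N: "\<And>x r. x \<in> S \<Longrightarrow> r > 0 \<Longrightarrow> emeasure N (ball x r) = g r"
    and pos: "\<And>r. r > 0 \<Longrightarrow> h r > 0" "\<And>r. r > 0 \<Longrightarrow> g r > 0"
  shows "M = N"
proof (rule measure_eqI_generator_eq[where \<Omega> = UNIV and E = "{S. open S}" and A = "\<lambda>_. UNIV"])
  interpret M: prob_space M by fact
  show "emeasure M X = emeasure N X" if "X \<in> {S. open S}" for X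
    using that
    by (intro antisym uniformly_distributed_le_open[OF pM pN s AE M N pos(1)]
        uniformly_distributed_le_open[OF pN pM s(2,1) AE(2,1) N M pos(2)]) auto
  show "emeasure M UNIV \<noteq> \<infinity>" by simp
qed (auto simp: s borel_def Int_stable_def)

text \<open>If the balls of radius \<open>r\<close> were null, countably many of them would cover
  \<open>S\<close> by Lindelof, although \<open>S\<close> has full measure.\<close>

lemma emeasure_ball_pos:
  fixes M :: "'a :: {metric_space, second_countable_topology} measure"
  assumes pM: "prob_space M" and s: "sets M = sets borel"
    and AE: "AE x in M. x \<in> S"
    and M: "\<And>x r. x \<in> S \<Longrightarrow> r > 0 \<Longrightarrow> emeasure M (ball x r) = h r"
    and r: "r > 0"
  shows "h r > 0"
proof (rule ccontr)
  interpret prob_space M by fact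
  assume "\<not> h r > 0"
  then have h0: "h r = 0" by simp
  obtain F where F: "F \<subseteq> (\<lambda>x. ball x r) ` S" "countable F" "\<Union> F = \<Union> ((\<lambda>x. ball x r) ` S)"
    using Lindelof[of "(\<lambda>x. ball x r) ` S"] by auto
  have "\<Union> F \<in> null_sets M"
    using F M[OF _ r] by (intro null_sets_UN'[of F "\<lambda>x. x", simplified]) (auto simp: null_sets_def s h0)
  then have "AE x in M. x \<notin> \<Union> F" by (rule AE_not_in)
  with AE have "AE x in M. False" by eventually_elim (use F r in auto)
  then show False by (simp add: emeasure_space_1 AE_False)
qed

section \<open>Uniform measures on spheres of subspaces\<close>

text \<open>The reflection in the hyperplane orthogonal to \<open>w\<close>. For
  \<open>w = 0\<close> division by zero makes it the identity, so that
  \<open>reflect (x - y)\<close> also covers \<open>x = y\<close>.\<close>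

definition reflect :: "'a :: real_inner \<Rightarrow> 'a \<Rightarrow> 'a" where
  "reflect w x = x - (2 * inner x w / inner w w) *\<^sub>R w"

lemma linear_reflect: "linear (reflect w)"
  by (rule linearI)
    (simp_all add: reflect_def inner_add_left algebra_simps add_divide_distrib)

lemma orthogonal_transformation_reflect: "orthogonal_transformation (reflect w)"
  unfolding orthogonal_transformation_def
proof (intro conjI allI linear_reflect)
  fix x y :: 'a
  show "inner (reflect w x) (reflect w y) = inner x y"
    by (cases "w = 0") (simp_all add: reflect_def inner_diff_left inner_diff_right inner_commute field_simps)
qed

lemma reflect_involution [simp]: "reflect w (reflect w x) = x"
  by (cases "w = 0") (simp_all add: reflect_def inner_diff_left scaleR_left_diff_distrib[symmetric])

lemma reflect_in_subspace: "subspace H \<Longrightarrow> w \<in> H \<Longrightarrow> x \<in> H \<Longrightarrow> reflect w x \<in> H"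
  by (auto simp: reflect_def intro: subspace_diff subspace_scale)

lemma reflect_image_subspace: "subspace H \<Longrightarrow> w \<in> H \<Longrightarrow> reflect w ` H = H"
  by (metis (no_types, lifting) image_eqI image_subsetI reflect_in_subspace reflect_involution subsetI subset_antisym)

text \<open>Equal norms give \<open>2 * inner x (x - y) = inner (x - y) (x - y)\<close>. Hence the
  reflections along vectors of a subspace act transitively on its unit sphere.\<close>

lemma reflect_swap:
  assumes "norm x = norm y"
  shows "reflect (x - y) x = y"
proof (cases "x = y")
  case False
  have "inner x x = inner y y" using assms by (simp add: norm_eq)
  then have "2 * inner x (x - y) = inner (x - y) (x - y)"
    by (simp add: inner_diff_left inner_diff_right inner_commute)
  then show ?thesis using False by (simp add: reflect_def)
qed (simp add: reflect_def)

lemma norm_reflect [simp]: "norm (reflect w x) = norm x"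
  using orthogonal_transformation_norm[OF orthogonal_transformation_reflect] .

lemma dist_reflect: "dist (reflect w x) y = dist x (reflect w y)"
  by (metis dist_norm linear_diff linear_reflect norm_reflect reflect_involution)

lemma continuous_on_reflect: "continuous_on X (reflect w)"
  unfolding reflect_def[abs_def] by (cases "w = 0") (auto intro!: continuous_intros)

section \<open>Reflection-invariant measures on spheres and their uniqueness\<close>

text \<open>A weaker demand than invariance under all orthogonal maps of \<open>H\<close>, yet
  enough for uniqueness. It is easy to verify for projected measures, since reflections along
  vectors of a subspace commute with the projection to it.\<close>

definition reflection_invariant :: "fvec set \<Rightarrow> fvec measure \<Rightarrow> bool" where
  "reflection_invariant H \<mu> \<longleftrightarrow> prob_space \<mu> \<and> sets \<mu> = sets (usphere_borel H) \<and>
     (\<forall>w\<in>H. distr \<mu> \<mu> (reflect w) = \<mu>)"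

lemma haar_usphere_reflection_invariant:
  "subspace H \<Longrightarrow> haar_usphere H \<mu> \<Longrightarrow> reflection_invariant H \<mu>"
  unfolding haar_usphere_def reflection_invariant_def
  by (simp add: orthogonal_transformation_reflect reflect_image_subspace)

lemma space_usphere_borel: "space (usphere_borel H) = usphere H"
  by (simp add: usphere_borel_def space_restrict_space)

lemma measurable_ident_usphere_borel:
  "sets \<mu> = sets (usphere_borel H) \<Longrightarrow> (\<lambda>x. x) \<in> measurable \<mu> borel"
  by (simp add: usphere_borel_def measurable_restrict_space1 cong: measurable_cong_sets)

lemma measurable_usphere_borel_borel: "(\<lambda>x. x) \<in> measurable (usphere_borel H) borel"
  by (rule measurable_ident_usphere_borel) simp

lemma measurable_into_usphere_borel:
  "f \<in> measurable M borel \<Longrightarrow> (\<And>x. x \<in> space M \<Longrightarrow> f x \<in> usphere H) \<Longrightarrow> f \<in> measurable M (usphere_borel H)"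
  unfolding usphere_borel_def by (rule measurable_restrict_space2) auto

lemma sets_usphere_borelE:
  assumes "A \<in> sets (usphere_borel H)"
  obtains B where "B \<in> sets borel" "A = B \<inter> usphere H"
  using assms by (auto simp: usphere_borel_def sets_restrict_space)

lemma sets_usphere_borelI: "B \<in> sets borel \<Longrightarrow> B \<inter> usphere H \<in> sets (usphere_borel H)"
  by (auto simp: usphere_borel_def sets_restrict_space)

lemma measurable_reflect_usphere:
  assumes "subspace H" "w \<in> H"
  shows "reflect w \<in> measurable (usphere_borel H) (usphere_borel H)"
proof (rule measurable_into_usphere_borel)
  show "reflect w \<in> measurable (usphere_borel H) borel"
    by (rule measurable_compose[OF measurable_usphere_borel_borel])
      (intro borel_measurable_continuous_onI continuous_on_reflect)
  show "reflect w x \<in> usphere H" if "x \<in> space (usphere_borel H)" for x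
    using that assms by (auto simp: space_usphere_borel usphere_def reflect_in_subspace)
qed

text \<open>The reflection along \<open>x - y\<close> is an isometric involution exchanging the two
  centres, hence the two balls, and it preserves the sphere and the measure.\<close>

lemma reflection_invariant_emeasure_ball:
  assumes H: "subspace H" and \<mu>: "reflection_invariant H \<mu>" and x: "x \<in> usphere H" and y: "y \<in> usphere H"
  shows "emeasure \<mu> (ball x r \<inter> usphere H) = emeasure \<mu> (ball y r \<inter> usphere H)"
proof -
  let ?T = "reflect (x - y)"
  have s: "sets \<mu> = sets (usphere_borel H)" and inv: "distr \<mu> \<mu> ?T = \<mu>"
    using \<mu> x y H by (auto simp: reflection_invariant_def usphere_def subspace_diff)
  have sp: "space \<mu> = usphere H" using sets_eq_imp_space_eq[OF s] by (simp add: space_usphere_borel)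
  have T: "?T \<in> measurable \<mu> \<mu>"
    using measurable_reflect_usphere[OF H, of "x - y"] x y H s
    by (auto simp: usphere_def subspace_diff cong: measurable_cong_sets)
  have in_sets: "ball x r \<inter> usphere H \<in> sets \<mu>" by (simp add: s sets_usphere_borelI)
  have Ty: "?T x = y" using x y by (intro reflect_swap) (simp add: usphere_def)
  have *: "?T -` (ball x r \<inter> usphere H) \<inter> usphere H = ball y r \<inter> usphere H"
  proof (intro set_eqI iffI)
    fix z assume "z \<in> ?T -` (ball x r \<inter> usphere H) \<inter> usphere H"
    then show "z \<in> ball y r \<inter> usphere H" using dist_reflect[of "x - y" z x] Ty by (auto simp: dist_commute)
  next
    fix z assume z: "z \<in> ball y r \<inter> usphere H"
    then have "?T z \<in> usphere H" using measurable_space[OF T, of z] sp by simp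
    then show "z \<in> ?T -` (ball x r \<inter> usphere H) \<inter> usphere H"
      using z dist_reflect[of "x - y" z x] Ty by (auto simp: dist_commute)
  qed
  have "emeasure \<mu> (ball x r \<inter> usphere H) = emeasure (distr \<mu> \<mu> ?T) (ball x r \<inter> usphere H)"
    by (simp add: inv)
  also have "\<dots> = emeasure \<mu> (ball y r \<inter> usphere H)"
    using emeasure_distr[OF T in_sets] by (simp only: sp *)
  finally show ?thesis .
qed

context
  fixes n :: nat and H :: "fvec set" and \<mu> :: "fvec measure" and x0 :: fvec
  assumes H: "subspace H" "H \<subseteq> Rn n" and \<mu>: "reflection_invariant H \<mu>" and x0: "x0 \<in> usphere H"
begin

text \<open>Pushing \<open>\<mu>\<close> to a Borel measure on the whole type supplies the
  hypotheses of \<open>uniformly_distributed_unique\<close>, with the sphere as \<open>S\<close>.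
  The fixed point \<open>x0\<close> names the common ball measure as a function of the radius
  alone.\<close>

lemma distr_borel_facts:
  shows "prob_space (distr \<mu> borel (\<lambda>x. x))" "AE x in distr \<mu> borel (\<lambda>x. x). x \<in> usphere H"
    "\<And>B. B \<in> sets borel \<Longrightarrow> emeasure (distr \<mu> borel (\<lambda>x. x)) B = emeasure \<mu> (B \<inter> usphere H)"
    "\<And>x r. x \<in> usphere H \<Longrightarrow> emeasure (distr \<mu> borel (\<lambda>x. x)) (ball x r) = emeasure \<mu> (ball x0 r \<inter> usphere H)"
    "\<And>r. r > 0 \<Longrightarrow> emeasure \<mu> (ball x0 r \<inter> usphere H) > 0"
proof -
  have s: "sets \<mu> = sets (usphere_borel H)" and p: "prob_space \<mu>"
    using \<mu> by (auto simp: reflection_invariant_def)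
  interpret prob_space \<mu> by fact
  have sp: "space \<mu> = usphere H" using sets_eq_imp_space_eq[OF s] by (simp add: space_usphere_borel)
  note id = measurable_ident_usphere_borel[OF s]
  show 1: "prob_space (distr \<mu> borel (\<lambda>x. x))" by (rule prob_space_distr[OF id])
  show 2: "AE x in distr \<mu> borel (\<lambda>x. x). x \<in> usphere H"
    using closed_usphere[OF H] by (subst AE_distr_iff[OF id]) (auto simp: sp[symmetric])
  show 3: "emeasure (distr \<mu> borel (\<lambda>x. x)) B = emeasure \<mu> (B \<inter> usphere H)" if "B \<in> sets borel" for B
    using that by (subst emeasure_distr[OF id]) (auto simp: sp)
  show 4: "emeasure (distr \<mu> borel (\<lambda>x. x)) (ball x r) = emeasure \<mu> (ball x0 r \<inter> usphere H)" 
    if "x \<in> usphere H" for x r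
    using reflection_invariant_emeasure_ball[OF H(1) \<mu> that x0] by (subst 3) auto
  show "emeasure \<mu> (ball x0 r \<inter> usphere H) > 0" if "r > 0" for r
    using emeasure_ball_pos[OF 1 _ 2 4 that] by simp
qed

end

lemma reflection_invariant_unique:
  assumes H: "subspace H" "H \<subseteq> Rn n" and \<mu>: "reflection_invariant H \<mu>" and \<nu>: "reflection_invariant H \<nu>"
  shows "\<mu> = \<nu>"
proof -
  have s: "sets \<mu> = sets (usphere_borel H)" "sets \<nu> = sets (usphere_borel H)" and p: "prob_space \<mu>"
    using \<mu> \<nu> by (auto simp: reflection_invariant_def)
  interpret prob_space \<mu> by fact
  have sp: "space \<mu> = usphere H" using sets_eq_imp_space_eq[OF s(1)] by (simp add: space_usphere_borel)
  obtain x0 where x0: "x0 \<in> usphere H" using not_empty sp by auto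
  note f = distr_borel_facts[OF H _ x0]
  have eq: "distr \<mu> borel (\<lambda>x. x) = distr \<nu> borel (\<lambda>x. x)"
    by (rule uniformly_distributed_unique[OF f(1)[OF \<mu>] f(1)[OF \<nu>] _ _ f(2)[OF \<mu>] f(2)[OF \<nu>]
          f(4)[OF \<mu>] f(4)[OF \<nu>] f(5)[OF \<mu>] f(5)[OF \<nu>]]) auto
  show ?thesis
  proof (rule measure_eqI)
    fix A assume "A \<in> sets \<mu>"
    then obtain B where B: "B \<in> sets borel" "A = B \<inter> usphere H" using s sets_usphere_borelE by metis
    then show "emeasure \<mu> A = emeasure \<nu> A"
      using f(3)[OF \<mu> B(1)] f(3)[OF \<nu> B(1)] eq by simp
  qed (simp add: s)
qed

section \<open>The uniform measure as the law of a normalised projection\<close>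

lemma measurable_sgn_fvec [measurable]: "(sgn :: fvec \<Rightarrow> fvec) \<in> measurable borel borel"
  unfolding sgn_div_norm[abs_def] by measurable

lemma measurable_orth_proj:
  assumes "subspace H" "H \<subseteq> Rn n"
  shows "orth_proj H \<in> measurable (usphere_borel (Rn n)) borel"
proof -
  note [measurable] = measurable_compose[OF measurable_usphere_borel_borel measurable_coord]
  have "(\<lambda>x. \<Sum>i<n. coord x i *\<^sub>R (\<Sum>j<n. coord (orth_proj H (unit_fvec i)) j *\<^sub>R unit_fvec j))
      \<in> measurable (usphere_borel (Rn n)) borel"
    by measurable
  then show ?thesis
    by (rule measurable_cong[THEN iffD2, rotated])
      (auto simp: space_usphere_borel usphere_def intro!: orth_proj_sum_unit[OF assms])
qed

text \<open>The reflection subtracts a multiple of \<open>w\<close>, which the projection fixes, and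
  the coefficient \<open>inner x w\<close> is the same for \<open>x\<close> and its
  projection.\<close>

lemma orth_proj_reflect:
  assumes "subspace H" "H \<subseteq> Rn n" "w \<in> H"
  shows "orth_proj H (reflect w x) = reflect w (orth_proj H x)"
  using assms
  by (simp add: reflect_def linear_diff[OF linear_orth_proj[OF assms(1,2)]]
      linear_scale[OF linear_orth_proj[OF assms(1,2)]] orth_proj_id inner_orth_proj)

lemma sgn_reflect: "sgn (reflect w x) = reflect w (sgn x)"
  by (simp add: sgn_div_norm linear_scale[OF linear_reflect])

lemma reflect_eq_0_iff [simp]: "reflect w x = 0 \<longleftrightarrow> x = 0"
  by (metis norm_eq_zero norm_reflect)

text \<open>
  The uniform measure on the sphere of \<open>K\<close> is the law of the normalised projection to \<open>K\<close> of a uniform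
  vector of the big sphere, conditioned on the projection being nonzero. This makes its dependence
  on \<open>K\<close> explicit, hence measurable.
\<close>

lemma emeasure_usphere_conv_orth_proj:
  assumes K: "subspace K" "K \<subseteq> Rn n" and s: "reflection_invariant (Rn n) s" and \<mu>: "reflection_invariant K \<mu>"
    and A: "A \<in> sets borel"
  defines "W \<equiv> {u \<in> usphere (Rn n). orth_proj K u \<noteq> 0}"
  shows "emeasure \<mu> (A \<inter> usphere K) = emeasure s {u \<in> usphere (Rn n). orth_proj K u \<noteq> 0 \<and> sgn (orth_proj K u) \<in> A} / emeasure s W"
proof -
  have ss: "sets s = sets (usphere_borel (Rn n))" and ps: "prob_space s"
    using s by (auto simp: reflection_invariant_def)
  have s\<mu>: "sets \<mu> = sets (usphere_borel K)" and p\<mu>: "prob_space \<mu>"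
    using \<mu> by (auto simp: reflection_invariant_def)
  interpret s: prob_space s by fact
  have sp: "space s = usphere (Rn n)" using sets_eq_imp_space_eq[OF ss] by (simp add: space_usphere_borel)
  have "space \<mu> = usphere K" using sets_eq_imp_space_eq[OF s\<mu>] by (simp add: space_usphere_borel)
  then obtain k where k: "k \<in> usphere K" using prob_space.not_empty[OF p\<mu>] by auto
  have kR: "k \<in> usphere (Rn n)" using k K by (auto simp: usphere_def)
  have [measurable]: "orth_proj K \<in> measurable s borel"
    using measurable_orth_proj[OF K] ss by (simp cong: measurable_cong_sets)
  have W_alt: "W = {u \<in> space s. orth_proj K u \<noteq> 0}" by (simp add: W_def sp)
  have W[measurable]: "W \<in> sets s" unfolding W_alt by measurable
  \<comment> \<open>A unit vector with zero projection is orthogonal to \<open>k\<close>, hence at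
    distance \<open>sqrt 2\<close> from it. So the ball of radius 1 avoids such vectors, and
    \<open>W\<close> has positive measure.\<close>
  have "ball k 1 \<inter> usphere (Rn n) \<subseteq> W"
  proof
    fix u assume u: "u \<in> ball k 1 \<inter> usphere (Rn n)"
    have "orth_proj K u \<noteq> 0"
    proof
      assume "orth_proj K u = 0"
      then have "inner u k = 0" using inner_orth_proj[OF K, of k u] k by (auto simp: usphere_def)
      then have "(dist k u)\<^sup>2 = 2" using u k
        by (simp add: dist_norm power2_norm_eq_inner inner_diff_left inner_diff_right inner_commute usphere_def norm_eq_1)
      moreover have "(dist k u)\<^sup>2 \<le> 1\<^sup>2" using u by (intro power_mono) auto
      ultimately show False by simp
    qed
    then show "u \<in> W" using u by (simp add: W_def)
  qed
  then have "emeasure s (ball k 1 \<inter> usphere (Rn n)) \<le> emeasure s W" by (rule emeasure_mono) measurable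
  then have pos: "emeasure s W > 0"
    using distr_borel_facts(5)[OF subspace_Rn subset_refl s kR, of 1] by simp
  \<comment> \<open>The default \<open>k\<close> keeps all values of \<open>\<phi>\<close> on the
    sphere of \<open>K\<close>; conditioning on \<open>W\<close> removes it from the law.\<close>
  define \<phi> where "\<phi> u = (if orth_proj K u = 0 then k else sgn (orth_proj K u))" for u
  have \<phi>m: "\<phi> \<in> measurable s (usphere_borel K)"
  proof (rule measurable_into_usphere_borel)
    show "\<phi> \<in> measurable s borel" unfolding \<phi>_def[abs_def] by measurable
    show "\<phi> u \<in> usphere K" for u :: fvec
      using k orth_proj_in[OF K, of u] K(1)
      by (auto simp: \<phi>_def usphere_def norm_sgn sgn_div_norm subspace_scale)
  qed
  define U where "U = uniform_measure s W"
  have pU: "prob_space U" unfolding U_def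
    using pos s.emeasure_finite by (intro prob_space_uniform_measure) auto
  have U: "emeasure U B = emeasure s (W \<inter> B) / emeasure s W" if "B \<in> sets s" for B
    using that by (simp add: U_def)
  have [simp]: "sets U = sets s" "space U = usphere (Rn n)" by (simp_all add: U_def sp)
  have \<phi>U: "\<phi> \<in> measurable U (usphere_borel K)" using \<phi>m by (simp cong: measurable_cong_sets)
  define \<nu> where "\<nu> = distr U (usphere_borel K) \<phi>"
  have "reflection_invariant K \<nu>"
    unfolding reflection_invariant_def
  proof (intro conjI ballI)
    show "prob_space \<nu>" unfolding \<nu>_def by (rule prob_space.prob_space_distr[OF pU \<phi>U])
    show "sets \<nu> = sets (usphere_borel K)" by (simp add: \<nu>_def)
    fix w assume w: "w \<in> K"
    let ?R = "reflect w"
    have wR: "w \<in> Rn n" using w K by auto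
    have Rs: "?R \<in> measurable s s"
      using measurable_reflect_usphere[OF subspace_Rn wR] ss by (simp cong: measurable_cong_sets)
    have RK: "?R \<in> measurable (usphere_borel K) (usphere_borel K)"
      by (rule measurable_reflect_usphere[OF K(1) w])
    have "distr \<nu> \<nu> ?R = distr U (usphere_borel K) (?R \<circ> \<phi>)"
      unfolding \<nu>_def by (subst distr_distr[OF _ \<phi>U, symmetric]) (auto simp: RK intro: distr_cong)
    also have "\<dots> = \<nu>"
    proof (rule measure_eqI)
      fix A assume "A \<in> sets (distr U (usphere_borel K) (?R \<circ> \<phi>))"
      then have A: "A \<in> sets (usphere_borel K)" by simp
      have 1: "\<phi> -` A \<inter> space s \<in> sets s" using \<phi>m A by (rule measurable_sets)
      have 2: "(?R \<circ> \<phi>) -` A \<inter> space s \<in> sets s"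
        using measurable_comp[OF \<phi>m RK] A by (rule measurable_sets)
      \<comment> \<open>The reflection preserves \<open>W\<close> and commutes with
        \<open>\<phi>\<close> there, so the invariance of \<open>s\<close> passes to the image of
        the conditioned measure.\<close>
      have "W \<inter> ((?R \<circ> \<phi>) -` A \<inter> space s) = ?R -` (W \<inter> (\<phi> -` A \<inter> space s)) \<inter> space s"
        using measurable_space[OF Rs]
        by (auto simp: W_alt \<phi>_def orth_proj_reflect[OF K w] sgn_reflect)
      also have "emeasure s \<dots> = emeasure (distr s s ?R) (W \<inter> (\<phi> -` A \<inter> space s))"
        using 1 W by (intro emeasure_distr[symmetric] Rs) auto
      also have "distr s s ?R = s" using s wR by (simp add: reflection_invariant_def)
      finally have "emeasure U ((?R \<circ> \<phi>) -` A \<inter> space s) = emeasure U (\<phi> -` A \<inter> space s)"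
        by (simp only: U[OF 1] U[OF 2])
      then show "emeasure (distr U (usphere_borel K) (?R \<circ> \<phi>)) A = emeasure \<nu> A"
        unfolding \<nu>_def using emeasure_distr[OF measurable_comp[OF \<phi>U RK] A] emeasure_distr[OF \<phi>U A]
        by (simp add: sp)
    qed (simp add: \<nu>_def)
    finally show "distr \<nu> \<nu> ?R = \<nu>" .
  qed
  then have eq: "\<mu> = \<nu>" by (rule reflection_invariant_unique[OF K \<mu>])
  from A have AK: "A \<inter> usphere K \<in> sets (usphere_borel K)" by (rule sets_usphere_borelI)
  have "emeasure \<mu> (A \<inter> usphere K) = emeasure U (\<phi> -` (A \<inter> usphere K) \<inter> space s)"
    unfolding eq \<nu>_def using emeasure_distr[OF \<phi>U AK] by (simp add: sp)
  also have "\<dots> = emeasure s (W \<inter> (\<phi> -` (A \<inter> usphere K) \<inter> space s)) / emeasure s W"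
    by (rule U[OF measurable_sets[OF \<phi>m AK]])
  also have "W \<inter> (\<phi> -` (A \<inter> usphere K) \<inter> space s)
      = {u \<in> usphere (Rn n). orth_proj K u \<noteq> 0 \<and> sgn (orth_proj K u) \<in> A}"
  proof (intro set_eqI iffI)
    fix u assume u: "u \<in> {u \<in> usphere (Rn n). orth_proj K u \<noteq> 0 \<and> sgn (orth_proj K u) \<in> A}"
    then have "\<phi> u \<in> usphere K" using measurable_space[OF \<phi>m, of u] by (simp add: sp space_usphere_borel)
    then show "u \<in> W \<inter> (\<phi> -` (A \<inter> usphere K) \<inter> space s)" using u by (simp add: W_def sp \<phi>_def)
  qed (auto simp: W_def sp \<phi>_def)
  finally show "emeasure \<mu> (A \<inter> usphere K) = emeasure s {u \<in> usphere (Rn n). orth_proj K u \<noteq> 0 \<and> sgn (orth_proj K u) \<in> A} / emeasure s W" .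
qed

section \<open>The sphere measures as a measurable kernel over the Grassmannian\<close>

text \<open>The measures for different subspaces live on different spheres; moving them to the
  sphere of \<open>Rn n\<close> gives the common target that a kernel requires.\<close>

definition sphere_kernel :: "nat \<Rightarrow> fvec measure \<Rightarrow> fvec measure" where
  "sphere_kernel n \<mu> = distr \<mu> (usphere_borel (Rn n)) (\<lambda>x. x)"

lemma
  assumes K: "K \<subseteq> Rn n" and \<mu>: "reflection_invariant K \<mu>"
  shows measurable_sphere_kernel_ident: "(\<lambda>x. x) \<in> measurable \<mu> (usphere_borel (Rn n))"
    and prob_space_sphere_kernel: "prob_space (sphere_kernel n \<mu>)"
    and emeasure_sphere_kernel: "A \<in> sets (usphere_borel (Rn n)) \<Longrightarrow> emeasure (sphere_kernel n \<mu>) A = emeasure \<mu> (A \<inter> K)"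
proof -
  have s: "sets \<mu> = sets (usphere_borel K)" and p: "prob_space \<mu>"
    using \<mu> by (auto simp: reflection_invariant_def)
  have sp: "space \<mu> = usphere K" using sets_eq_imp_space_eq[OF s] by (simp add: space_usphere_borel)
  show 1: "(\<lambda>x. x) \<in> measurable \<mu> (usphere_borel (Rn n))"
    using K by (intro measurable_into_usphere_borel measurable_ident_usphere_borel[OF s])
      (auto simp: sp usphere_def)
  show "prob_space (sphere_kernel n \<mu>)"
    unfolding sphere_kernel_def by (rule prob_space.prob_space_distr[OF p 1])
  assume A: "A \<in> sets (usphere_borel (Rn n))"
  then have "A \<inter> usphere K = A \<inter> K"
    using sets.sets_into_space[OF A] by (auto simp: space_usphere_borel usphere_def)
  then show "emeasure (sphere_kernel n \<mu>) A = emeasure \<mu> (A \<inter> K)"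
    unfolding sphere_kernel_def using emeasure_distr[OF 1 A] by (simp add: sp)
qed

lemma AE_sphere_kernel:
  assumes K: "subspace K" "K \<subseteq> Rn n" and \<mu>: "reflection_invariant K \<mu>"
  shows "AE u in sphere_kernel n \<mu>. u \<in> usphere K"
proof -
  have "space \<mu> = usphere K"
    using \<mu> sets_eq_imp_space_eq[of \<mu> "usphere_borel K"] by (simp add: reflection_invariant_def space_usphere_borel)
  then have "AE u in \<mu>. u \<in> usphere K" by (simp flip: \<open>space \<mu> = usphere K\<close>)
  moreover have "{u \<in> space (usphere_borel (Rn n)). u \<in> usphere K} \<in> sets (usphere_borel (Rn n))"
    using sets_usphere_borelI[of "usphere K" "Rn n"] closed_usphere[OF K]
    by (simp add: space_usphere_borel Int_def conj_commute)
  ultimately show ?thesis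
    unfolding sphere_kernel_def by (simp add: AE_distr_iff[OF measurable_sphere_kernel_ident[OF K(2) \<mu>]])
qed

text \<open>\<open>emeasure_usphere_conv_orth_proj\<close> writes each value as a quotient of
  \<open>s\<close>-measures of sections of jointly measurable sets, and these depend measurably on
  \<open>h\<close>. The map \<open>K\<close> is general because both \<open>H\<close> and
  \<open>perp n H\<close> are needed.\<close>

lemma measurable_sphere_kernel:
  assumes K: "\<And>h. h \<in> space N \<Longrightarrow> subspace (K h) \<and> K h \<subseteq> Rn n"
    and s: "reflection_invariant (Rn n) s"
    and \<mu>: "\<And>h. h \<in> space N \<Longrightarrow> reflection_invariant (K h) (\<mu> h)"
    and P: "(\<lambda>(h, u). orth_proj (K h) u) \<in> measurable (N \<Otimes>\<^sub>M usphere_borel (Rn n)) borel"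
  shows "(\<lambda>h. sphere_kernel n (\<mu> h)) \<in> measurable N (subprob_algebra (usphere_borel (Rn n)))"
proof (rule measurable_subprob_algebra)
  fix h assume h: "h \<in> space N"
  show "subprob_space (sphere_kernel n (\<mu> h))"
    using prob_space_sphere_kernel[OF _ \<mu>[OF h]] K[OF h] by (simp add: prob_space_imp_subprob_space)
  show "sets (sphere_kernel n (\<mu> h)) = sets (usphere_borel (Rn n))"
    by (simp add: sphere_kernel_def)
next
  have ss: "sets s = sets (usphere_borel (Rn n))" and ps: "prob_space s"
    using s by (auto simp: reflection_invariant_def)
  interpret s: prob_space s by fact
  have sp: "space s = usphere (Rn n)" using sets_eq_imp_space_eq[OF ss] by (simp add: space_usphere_borel)
  have [measurable]: "(\<lambda>p. orth_proj (K (fst p)) (snd p)) \<in> measurable (N \<Otimes>\<^sub>M s) borel"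
    using P ss by (simp add: case_prod_beta cong: measurable_cong_sets sets_pair_measure_cong)
  have meas: "(\<lambda>h. emeasure s {u \<in> space s. orth_proj (K h) u \<noteq> 0 \<and> sgn (orth_proj (K h) u) \<in> B})
      \<in> borel_measurable N" if [measurable]: "B \<in> sets borel" for B
  proof -
    have "{p \<in> space (N \<Otimes>\<^sub>M s). orth_proj (K (fst p)) (snd p) \<noteq> 0 \<and> sgn (orth_proj (K (fst p)) (snd p)) \<in> B}
        \<in> sets (N \<Otimes>\<^sub>M s)"
      by measurable
    from s.measurable_emeasure_Pair[OF this] show ?thesis
      by (rule measurable_cong[THEN iffD1, rotated])
        (auto intro!: arg_cong[of _ _ "emeasure s"] simp: space_pair_measure)
  qed
  fix A assume A: "A \<in> sets (usphere_borel (Rn n))"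
  then obtain B where B: "B \<in> sets borel" "A = B \<inter> usphere (Rn n)" by (rule sets_usphere_borelE)
  \<comment> \<open>The denominator is the normalising constant, written with \<open>UNIV\<close> so
    that \<open>meas\<close> covers it too.\<close>
  have "emeasure (sphere_kernel n (\<mu> h)) A
      = emeasure s {u \<in> space s. orth_proj (K h) u \<noteq> 0 \<and> sgn (orth_proj (K h) u) \<in> B}
        / emeasure s {u \<in> space s. orth_proj (K h) u \<noteq> 0 \<and> sgn (orth_proj (K h) u) \<in> UNIV}"
    if h: "h \<in> space N" for h
  proof -
    have "A \<inter> K h = B \<inter> usphere (K h)" using B K[OF h] by (auto simp: usphere_def)
    then show ?thesis
      using emeasure_sphere_kernel[OF _ \<mu>[OF h] A] K[OF h]
        emeasure_usphere_conv_orth_proj[OF _ _ s \<mu>[OF h] B(1)] by (simp add: sp)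
  qed
  then show "(\<lambda>h. emeasure (sphere_kernel n (\<mu> h)) A) \<in> borel_measurable N"
    by (subst measurable_cong) (assumption, intro borel_measurable_divide_ennreal meas B(1), simp)
qed

lemma measurable_orth_proj_Gr:
  "(\<lambda>(H, u). orth_proj H u) \<in> measurable (Gr_borel n k \<Otimes>\<^sub>M usphere_borel (Rn n)) borel"
proof -
  have [measurable]: "(\<lambda>H. coord (orth_proj H (unit_fvec i)) j) \<in> borel_measurable (Gr_borel n k)" for i j
  proof -
    have 1: "(\<lambda>H (i, j). coord (orth_proj H (unit_fvec i)) j) \<in> measurable (Gr_borel n k) borel"
      unfolding Gr_borel_def by (rule measurable_vimage_algebra1) auto
    have 2: "(\<lambda>F. F (i, j)) \<in> borel_measurable (borel :: (nat \<times> nat \<Rightarrow> real) measure)"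
      by (intro borel_measurable_continuous_onI continuous_on_product_coordinates)
    show ?thesis using measurable_compose[OF 1 2] by simp
  qed
  note [measurable] = measurable_compose[OF measurable_usphere_borel_borel measurable_coord]
  have "(\<lambda>p. \<Sum>i<n. coord (snd p) i *\<^sub>R (\<Sum>j<n. coord (orth_proj (fst p) (unit_fvec i)) j *\<^sub>R unit_fvec j))
      \<in> measurable (Gr_borel n k \<Otimes>\<^sub>M usphere_borel (Rn n)) borel"
    by measurable
  then show ?thesis
    by (rule measurable_cong[THEN iffD2, rotated])
      (auto simp: space_usphere_borel usphere_def space_pair_measure Gr_borel_def Gr_def
        intro!: orth_proj_sum_unit)
qed

lemma measurable_orth_proj_perp_Gr:
  "(\<lambda>(H, u). orth_proj (perp n H) u) \<in> measurable (Gr_borel n k \<Otimes>\<^sub>M usphere_borel (Rn n)) borel"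
proof -
  note [measurable] = measurable_orth_proj_Gr[unfolded case_prod_beta] measurable_usphere_borel_borel
  have "(\<lambda>p. snd p - orth_proj (fst p) (snd p)) \<in> measurable (Gr_borel n k \<Otimes>\<^sub>M usphere_borel (Rn n)) borel"
    by measurable
  then show ?thesis
    by (rule measurable_cong[THEN iffD2, rotated])
      (auto simp: space_usphere_borel usphere_def space_pair_measure Gr_borel_def Gr_def
        intro!: orth_proj_perp)
qed

text \<open>Makes the sphere measures available on both sides of the promise: a zero
  \<open>H\<close> has dimension 0, and a zero complement forces \<open>H = Rn n\<close>, of
  dimension \<open>n\<close>.\<close>

lemma Gr_nontrivial:
  assumes "H \<in> Gr n k" "0 < k" "k < n"
  shows "subspace H" "H \<subseteq> Rn n" "H \<noteq> {0}" "subspace (perp n H)" "perp n H \<subseteq> Rn n" "perp n H \<noteq> {0}"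
proof -
  show H: "subspace H" "H \<subseteq> Rn n" using assms by (auto simp: Gr_def)
  have "dim {0 :: fvec} = 0" by (rule dim_unique[of "{}"]) (auto simp: independent_empty)
  then show "H \<noteq> {0}" using assms by (auto simp: Gr_def)
  show "subspace (perp n H)" by (rule subspace_perp[OF H])
  show "perp n H \<subseteq> Rn n" by (rule perp_subset[OF H])
  show "perp n H \<noteq> {0}" using perp_eq_zeroD[OF H] assms dim_Rn[of n] by (auto simp: Gr_def)
qed

section \<open>Errors of deterministic protocols\<close>

text \<open>Alice's side of the rectangles at the leaves, ignoring Bob's side.\<close>

primrec leaf_sets :: "protocol \<Rightarrow> fvec set \<Rightarrow> fvec set list" where
  "leaf_sets (Answer b) A = [A]"
| "leaf_sets (Alice f p q) A = leaf_sets p (A \<inter> {u. f u}) @ leaf_sets q (A \<inter> {u. \<not> f u})"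
| "leaf_sets (Bob g p q) A = leaf_sets p A @ leaf_sets q A"

lemma length_leaf_sets: "length (leaf_sets p A) \<le> 2 ^ depth p"
proof (induction p arbitrary: A)
  case (Alice f p q)
  have "(2::nat) ^ depth p \<le> 2 ^ max (depth p) (depth q)" "(2::nat) ^ depth q \<le> 2 ^ max (depth p) (depth q)"
    by (auto intro: power_increasing)
  then show ?case using Alice[of "A \<inter> {u. f u}"] Alice[of "A \<inter> {u. \<not> f u}"]
    by (simp only: leaf_sets.simps length_append depth.simps power_Suc)
next
  case (Bob g p q)
  have "(2::nat) ^ depth p \<le> 2 ^ max (depth p) (depth q)" "(2::nat) ^ depth q \<le> 2 ^ max (depth p) (depth q)"
    by (auto intro: power_increasing)
  then show ?case using Bob[of A]
    by (simp only: leaf_sets.simps length_append depth.simps power_Suc)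
qed simp

lemma measurable_Int_Collect:
  assumes "f \<in> measurable M (count_space UNIV)" "A \<in> sets M"
  shows "A \<inter> {u. f u} \<in> sets M" "A \<inter> {u. \<not> f u} \<in> sets M"
proof -
  have "{u \<in> space M. f u} \<in> sets M" "{u \<in> space M. \<not> f u} \<in> sets M" using assms(1) by measurable
  then have "A \<inter> {u \<in> space M. f u} \<in> sets M" "A \<inter> {u \<in> space M. \<not> f u} \<in> sets M" using assms(2) by auto
  moreover have "A \<inter> {u. f u} = A \<inter> {u \<in> space M. f u}" "A \<inter> {u. \<not> f u} = A \<inter> {u \<in> space M. \<not> f u}"
    using sets.sets_into_space[OF assms(2)] by auto
  ultimately show "A \<inter> {u. f u} \<in> sets M" "A \<inter> {u. \<not> f u} \<in> sets M" by simp_all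
qed

lemma leaf_sets_measurable:
  "det_protocol n p \<Longrightarrow> A \<in> sets (usphere_borel (Rn n)) \<Longrightarrow> set (leaf_sets p A) \<subseteq> sets (usphere_borel (Rn n))"
  by (induction p arbitrary: A) (auto dest: measurable_Int_Collect)

lemma measurable_run:
  "det_protocol n p \<Longrightarrow> (\<lambda>u. run p u H) \<in> measurable (usphere_borel (Rn n)) (count_space UNIV)"
  by (induction p) auto

text \<open>AM-GM with weights of product 1/4. Multiplied by 20 it reads
  \<open>20 * sqrt (a * b) \<le> 4 * a + 25 * b\<close>; with \<open>20 * 0.9 = 18\<close> this
  explains the constants of the estimate for the leaves.\<close>

lemma sqrt_le_weighted_sum:
  fixes a b :: real
  assumes "a \<ge> 0" "b \<ge> 0"
  shows "sqrt (a * b) \<le> 1 / 5 * a + 5 / 4 * b"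
proof (rule real_le_lsqrt)
  have "0 \<le> (1 / 5 * a - 5 / 4 * b)\<^sup>2" by simp
  then show "a * b \<le> (1 / 5 * a + 5 / 4 * b)\<^sup>2" by (simp add: power2_eq_square algebra_simps)
qed (use assms in auto)

lemma measure_Int_if:
  assumes "finite_measure m" "A \<inter> {u. f u} \<inter> {u. c u} \<in> sets m" "A \<inter> {u. \<not> f u} \<inter> {u. d u} \<in> sets m"
  shows "measure m (A \<inter> {u. if f u then c u else d u})
    = measure m (A \<inter> {u. f u} \<inter> {u. c u}) + measure m (A \<inter> {u. \<not> f u} \<inter> {u. d u})"
proof -
  interpret finite_measure m by fact
  have "A \<inter> {u. if f u then c u else d u} = (A \<inter> {u. f u} \<inter> {u. c u}) \<union> (A \<inter> {u. \<not> f u} \<inter> {u. d u})"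
    by auto
  then show ?thesis using finite_measure_Union[OF assms(2,3)] by auto
qed

text \<open>
  Every leaf contributes to the affinity of the two answer distributions; the weights in the AM-GM
  inequality penalise the side on which the leaf's answer is wrong.
\<close>

lemma affinity_le_weighted_error:
  fixes \<tau> :: real
  assumes x: "finite_measure x" "sets x = sets (usphere_borel (Rn n))"
    and y: "finite_measure y" "sets y = sets (usphere_borel (Rn n))"
    and s: "finite_measure s" "sets s = sets (usphere_borel (Rn n))"
    and \<tau>: "\<tau> \<ge> 0"
  shows "det_protocol n p \<Longrightarrow> A \<in> sets (usphere_borel (Rn n)) \<Longrightarrow>
    (\<And>L. L \<in> set (leaf_sets p A) \<Longrightarrow> measure s L \<ge> \<tau> \<Longrightarrow>
       sqrt (measure x L * measure y L) \<ge> 0.9 * measure s L) \<Longrightarrow>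
    18 * (measure s A - length (leaf_sets p A) * \<tau>) \<le>
      4 * measure x (A \<inter> {u. run p u H}) + 25 * measure y (A \<inter> {u. run p u H}) +
      (4 * measure y (A \<inter> {u. \<not> run p u H}) + 25 * measure x (A \<inter> {u. \<not> run p u H}))"
proof (induction p arbitrary: A)
  case (Answer b)
  \<comment> \<open>Both weightings are proved because the label \<open>b\<close> decides which side
    errs. For a leaf below the threshold \<open>\<tau>\<close> the left side is negative, so each
    leaf costs at most \<open>\<tau>\<close>.\<close>
  have "18 * (measure s A - \<tau>) \<le> 4 * measure x A + 25 * measure y A \<and>
        18 * (measure s A - \<tau>) \<le> 4 * measure y A + 25 * measure x A"
  proof (cases "measure s A \<ge> \<tau>")
    case True
    then show ?thesis using Answer(3)[of A] \<tau> sqrt_le_weighted_sum[of "measure x A" "measure y A"]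
        sqrt_le_weighted_sum[of "measure y A" "measure x A"]
      by (simp add: mult.commute)
  next
    case False
    then have "18 * (measure s A - \<tau>) \<le> 0" by simp
    moreover have "0 \<le> 4 * measure x A + 25 * measure y A" "0 \<le> 4 * measure y A + 25 * measure x A"
      by simp_all
    ultimately show ?thesis by (meson order.trans)
  qed
  then show ?case by (cases b) auto
next
  case (Alice f p q)
  \<comment> \<open>All measures are additive over Alice's two pieces of \<open>A\<close>, and the
    leaf counts add.\<close>
  let ?S = "usphere_borel (Rn n)"
  have p: "det_protocol n p" and q: "det_protocol n q" and f: "f \<in> measurable ?S (count_space UNIV)"
    using Alice.prems by auto
  have Af: "A \<inter> {u. f u} \<in> sets ?S" "A \<inter> {u. \<not> f u} \<in> sets ?S"
    using measurable_Int_Collect[OF f Alice.prems(2)] .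
  note mp = measurable_Int_Collect[OF measurable_run[OF p, of H] Af(1)]
  note mq = measurable_Int_Collect[OF measurable_run[OF q, of H] Af(2)]
  note split = measure_Int_if[where A = A and f = f]
  have 1: "measure s A = measure s (A \<inter> {u. f u}) + measure s (A \<inter> {u. \<not> f u})"
    using split[OF s(1), of "\<lambda>_. True" "\<lambda>_. True"] Af by (simp add: s(2))
  have 2: "measure x (A \<inter> {u. run (Alice f p q) u H}) = measure x (A \<inter> {u. f u} \<inter> {u. run p u H})
      + measure x (A \<inter> {u. \<not> f u} \<inter> {u. run q u H})"
    using split[OF x(1), unfolded x(2), OF mp(1) mq(1)] by (simp add: if_distribR)
  have 3: "measure y (A \<inter> {u. run (Alice f p q) u H}) = measure y (A \<inter> {u. f u} \<inter> {u. run p u H})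
      + measure y (A \<inter> {u. \<not> f u} \<inter> {u. run q u H})"
    using split[OF y(1), unfolded y(2), OF mp(1) mq(1)] by (simp add: if_distribR)
  have neg: "{u. \<not> run (Alice f p q) u H} = {u. if f u then \<not> run p u H else \<not> run q u H}" by auto
  have 4: "measure x (A \<inter> {u. \<not> run (Alice f p q) u H}) = measure x (A \<inter> {u. f u} \<inter> {u. \<not> run p u H})
      + measure x (A \<inter> {u. \<not> f u} \<inter> {u. \<not> run q u H})"
    unfolding neg by (rule split[OF x(1), unfolded x(2), OF mp(2) mq(2)])
  have 5: "measure y (A \<inter> {u. \<not> run (Alice f p q) u H}) = measure y (A \<inter> {u. f u} \<inter> {u. \<not> run p u H})
      + measure y (A \<inter> {u. \<not> f u} \<inter> {u. \<not> run q u H})"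
    unfolding neg by (rule split[OF y(1), unfolded y(2), OF mp(2) mq(2)])
  have P: "18 * (measure s (A \<inter> {u. f u}) - length (leaf_sets p (A \<inter> {u. f u})) * \<tau>) \<le>
      4 * measure x (A \<inter> {u. f u} \<inter> {u. run p u H}) + 25 * measure y (A \<inter> {u. f u} \<inter> {u. run p u H}) +
      (4 * measure y (A \<inter> {u. f u} \<inter> {u. \<not> run p u H}) + 25 * measure x (A \<inter> {u. f u} \<inter> {u. \<not> run p u H}))"
    by (rule Alice.IH(1)[OF p Af(1)]) (rule Alice.prems(3), simp_all)
  have Q: "18 * (measure s (A \<inter> {u. \<not> f u}) - length (leaf_sets q (A \<inter> {u. \<not> f u})) * \<tau>) \<le>
      4 * measure x (A \<inter> {u. \<not> f u} \<inter> {u. run q u H}) + 25 * measure y (A \<inter> {u. \<not> f u} \<inter> {u. run q u H}) +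
      (4 * measure y (A \<inter> {u. \<not> f u} \<inter> {u. \<not> run q u H}) + 25 * measure x (A \<inter> {u. \<not> f u} \<inter> {u. \<not> run q u H}))"
    by (rule Alice.IH(2)[OF q Af(2)]) (rule Alice.prems(3), simp_all)
  have 6: "real (length (leaf_sets (Alice f p q) A)) * \<tau> = length (leaf_sets p (A \<inter> {u. f u})) * \<tau>
      + length (leaf_sets q (A \<inter> {u. \<not> f u})) * \<tau>"
    by (simp add: distrib_right)
  show ?case using P Q 1 2 3 4 5 6 by argo
next
  case (Bob g p q)
  \<comment> \<open>For a fixed \<open>H\<close> only one subtree is run. Counting the leaves of the
    other one as well only weakens the bound, and it keeps the leaf sets independent of
    \<open>H\<close>.\<close>
  let ?r = "if g H then p else q"
  have "18 * (measure s A - length (leaf_sets ?r A) * \<tau>) \<le>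
      4 * measure x (A \<inter> {u. run ?r u H}) + 25 * measure y (A \<inter> {u. run ?r u H}) +
      (4 * measure y (A \<inter> {u. \<not> run ?r u H}) + 25 * measure x (A \<inter> {u. \<not> run ?r u H}))"
    using Bob.IH[of A] Bob.prems by (cases "g H") simp_all
  moreover have "run (Bob g p q) u H = run ?r u H" for u by simp
  moreover have "length (leaf_sets ?r A) * \<tau> \<le> length (leaf_sets (Bob g p q) A) * \<tau>"
    using \<tau> by (intro mult_right_mono) auto
  ultimately show ?case by (simp only:) argo
qed

section \<open>Lower bounds for the error at one subspace and on average\<close>

text \<open>The thresholds lose at most 1/9, so the weighted sum is at least
  \<open>18 * (1 - 1/9) = 16\<close>. The correct answers, of weight 4 and mass at most 1 on each
  side, account for at most 8, which leaves at least 8 for the errors of weight 25.\<close>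

lemma error_lower_bound_pointwise:
  fixes \<tau> :: real
  assumes x: "prob_space x" "sets x = sets (usphere_borel (Rn n))"
    and y: "prob_space y" "sets y = sets (usphere_borel (Rn n))"
    and s: "prob_space s" "sets s = sets (usphere_borel (Rn n))"
    and \<tau>: "\<tau> \<ge> 0" "2 ^ depth p * \<tau> \<le> 1 / 9"
    and p: "det_protocol n p"
    and good: "\<And>L. L \<in> set (leaf_sets p (usphere (Rn n))) \<Longrightarrow> measure s L \<ge> \<tau> \<Longrightarrow>
       sqrt (measure x L * measure y L) \<ge> 0.9 * measure s L"
  shows "measure x {u \<in> usphere (Rn n). \<not> run p u H} + measure y {u \<in> usphere (Rn n). run p u H} \<ge> 8 / 25"
proof -
  interpret x: prob_space x by fact
  interpret y: prob_space y by fact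
  interpret s: prob_space s by fact
  let ?A = "usphere (Rn n)"
  have A: "?A \<in> sets (usphere_borel (Rn n))"
    using sets.top[of "usphere_borel (Rn n)"] by (simp add: space_usphere_borel)
  have sA: "measure s ?A = 1"
    using s.prob_space sets_eq_imp_space_eq[OF s(2)] by (simp add: space_usphere_borel)
  have "length (leaf_sets p ?A) * \<tau> \<le> 2 ^ depth p * \<tau>"
    using of_nat_mono[OF length_leaf_sets[of p ?A], where 'a = real] \<tau>(1) by (intro mult_right_mono) simp_all
  then have "16 \<le> 18 * (measure s ?A - length (leaf_sets p ?A) * \<tau>)"
    using \<tau>(2) unfolding sA by argo
  also have "\<dots> \<le> 4 * measure x (?A \<inter> {u. run p u H}) + 25 * measure y (?A \<inter> {u. run p u H}) +
      (4 * measure y (?A \<inter> {u. \<not> run p u H}) + 25 * measure x (?A \<inter> {u. \<not> run p u H}))"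
    by (rule affinity_le_weighted_error[OF _ x(2) _ y(2) _ s(2) \<tau>(1) p A good])
      (simp_all add: x.finite_measure_axioms y.finite_measure_axioms s.finite_measure_axioms)
  finally have "16 \<le> 4 * measure x (?A \<inter> {u. run p u H}) + 25 * measure y (?A \<inter> {u. run p u H}) +
      (4 * measure y (?A \<inter> {u. \<not> run p u H}) + 25 * measure x (?A \<inter> {u. \<not> run p u H}))" .
  moreover have "measure x (?A \<inter> {u. run p u H}) \<le> 1" "measure y (?A \<inter> {u. \<not> run p u H}) \<le> 1"
    by simp_all
  moreover have eq: "{u \<in> ?A. \<not> run p u H} = ?A \<inter> {u. \<not> run p u H}" "{u \<in> ?A. run p u H} = ?A \<inter> {u. run p u H}"
    by auto
  ultimately show ?thesis unfolding eq by argo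
qed

text \<open>The leaf sets do not depend on \<open>H\<close>, so a union bound over at most
  \<open>2 ^ depth p\<close> of them leaves exceptional subspaces of measure at most 1/4. On the
  others the pointwise bound applies, and \<open>8/25 * 3/4 = 6/25\<close>.\<close>

lemma error_lower_bound_average:
  fixes \<tau> \<eta> :: real
  assumes s: "prob_space s" "sets s = sets (usphere_borel (Rn n))"
    and g: "prob_space g" 
    and x: "x \<in> measurable g (subprob_algebra (usphere_borel (Rn n)))" "\<And>H. H \<in> space g \<Longrightarrow> prob_space (x H)"
    and y: "y \<in> measurable g (subprob_algebra (usphere_borel (Rn n)))" "\<And>H. H \<in> space g \<Longrightarrow> prob_space (y H)"
    and \<tau>: "\<tau> \<ge> 0" "2 ^ depth p * \<tau> \<le> 1 / 9"
    and \<eta>: "\<eta> \<ge> 0" "2 ^ depth p * \<eta> \<le> 1 / 4"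
    and p: "det_protocol n p"
    and sampling: "\<And>A. A \<in> sets (usphere_borel (Rn n)) \<Longrightarrow> measure s A \<ge> \<tau> \<Longrightarrow>
      measure g {H \<in> space g. sqrt (measure (x H) A * measure (y H) A) \<ge> 0.9 * measure s A} \<ge> 1 - \<eta>"
  shows "(\<integral>\<^sup>+H. emeasure (x H) {u \<in> usphere (Rn n). \<not> run p u H}
      + emeasure (y H) {u \<in> usphere (Rn n). run p u H} \<partial>g) \<ge> ennreal (6 / 25)"
proof -
  interpret g: prob_space g by fact
  let ?A = "usphere (Rn n)"
  have A: "?A \<in> sets (usphere_borel (Rn n))"
    using sets.top[of "usphere_borel (Rn n)"] by (simp add: space_usphere_borel)
  define Ls where "Ls = {L \<in> set (leaf_sets p ?A). measure s L \<ge> \<tau>}"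
  define G where "G L = {H \<in> space g. sqrt (measure (x H) L * measure (y H) L) \<ge> 0.9 * measure s L}" for L
  have Ls: "finite Ls" "Ls \<subseteq> sets (usphere_borel (Rn n))" "\<And>L. L \<in> Ls \<Longrightarrow> measure s L \<ge> \<tau>"
    using leaf_sets_measurable[OF p A] by (auto simp: Ls_def)
  have cardLs: "real (card Ls) \<le> 2 ^ depth p"
  proof -
    have "card Ls \<le> card (set (leaf_sets p ?A))" unfolding Ls_def by (rule card_mono) auto
    also have "\<dots> \<le> length (leaf_sets p ?A)" by (rule card_length)
    also have "\<dots> \<le> 2 ^ depth p" by (rule length_leaf_sets)
    finally have "real (card Ls) \<le> real (2 ^ depth p)" by (rule of_nat_mono)
    then show ?thesis by simp
  qed
  have G: "G L \<in> sets g" if "L \<in> Ls" for L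
  proof -
    have L: "L \<in> sets (usphere_borel (Rn n))" using that Ls by auto
    have [measurable]: "(\<lambda>H. measure (x H) L) \<in> borel_measurable g" "(\<lambda>H. measure (y H) L) \<in> borel_measurable g"
      by (intro measurable_compose[OF _ measurable_measure_subprob_algebra[OF L]] x y)+
    show ?thesis unfolding G_def by measurable
  qed
  define B where "B = (\<Union>L\<in>Ls. space g - G L)"
  have B: "B \<in> sets g" unfolding B_def by (intro sets.finite_UN Ls(1) sets.compl_sets G)
  have "g.prob B \<le> (\<Sum>L\<in>Ls. g.prob (space g - G L))"
    unfolding B_def using Ls(1) G by (intro g.finite_measure_subadditive_finite) auto
  also have "\<dots> \<le> (\<Sum>L\<in>Ls. \<eta>)"
  proof (rule sum_mono)
    fix L assume L: "L \<in> Ls"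
    then have "1 - \<eta> \<le> g.prob (G L)" unfolding G_def using Ls by (intro sampling) auto
    then show "g.prob (space g - G L) \<le> \<eta>" using g.prob_compl[OF G[OF L]] by simp
  qed
  also have "\<dots> \<le> 2 ^ depth p * \<eta>" using cardLs \<eta>(1) by (simp add: mult_right_mono)
  also have "\<dots> \<le> 1 / 4" by fact
  finally have B': "g.prob (space g - B) \<ge> 3 / 4" using g.prob_compl[OF B] by simp
  have "ennreal (6 / 25) \<le> ennreal (8 / 25 * g.prob (space g - B))" using B' by (intro ennreal_leI) simp
  also have "\<dots> = ennreal (8 / 25) * emeasure g (space g - B)"
    unfolding g.emeasure_eq_measure by (rule ennreal_mult) simp_all
  also have "\<dots> = (\<integral>\<^sup>+H. ennreal (8 / 25) * indicator (space g - B) H \<partial>g)"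
    using B by (simp add: nn_integral_cmult_indicator)
  also have "\<dots> \<le> (\<integral>\<^sup>+H. emeasure (x H) {u \<in> ?A. \<not> run p u H} + emeasure (y H) {u \<in> ?A. run p u H} \<partial>g)"
  proof (rule nn_integral_mono)
    fix H assume H: "H \<in> space g"
    interpret x: prob_space "x H" by (rule x(2)[OF H])
    interpret y: prob_space "y H" by (rule y(2)[OF H])
    have xs: "sets (x H) = sets (usphere_borel (Rn n))" "sets (y H) = sets (usphere_borel (Rn n))"
      using sets_kernel[OF x(1) H] sets_kernel[OF y(1) H] by auto
    show "ennreal (8 / 25) * indicator (space g - B) H \<le> emeasure (x H) {u \<in> ?A. \<not> run p u H} + emeasure (y H) {u \<in> ?A. run p u H}"
    proof (cases "H \<in> B")
      case False
      have "8 / 25 \<le> measure (x H) {u \<in> ?A. \<not> run p u H} + measure (y H) {u \<in> ?A. run p u H}"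
        using False H
        by (intro error_lower_bound_pointwise[OF x(2)[OF H] xs(1) y(2)[OF H] xs(2) s \<tau> p])
          (auto simp: B_def Ls_def G_def)
      then show ?thesis using H False
        by (simp add: x.emeasure_eq_measure y.emeasure_eq_measure ennreal_leI flip: ennreal_plus)
    qed simp
  qed
  finally show ?thesis .
qed

section \<open>Majority votes\<close>

primrec bind_protocol :: "protocol \<Rightarrow> (bool \<Rightarrow> protocol) \<Rightarrow> protocol" where
  "bind_protocol (Answer b) k = k b"
| "bind_protocol (Alice f p q) k = Alice f (bind_protocol p k) (bind_protocol q k)"
| "bind_protocol (Bob g p q) k = Bob g (bind_protocol p k) (bind_protocol q k)"

lemma run_bind_protocol [simp]: "run (bind_protocol p k) u H = run (k (run p u H)) u H"
  by (induction p) auto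

lemma depth_bind_protocol: "(\<And>b. depth (k b) \<le> d) \<Longrightarrow> depth (bind_protocol p k) \<le> depth p + d"
  by (induction p) (auto simp: max_def)

lemma det_protocol_bind: "det_protocol n p \<Longrightarrow> (\<And>b. det_protocol n (k b)) \<Longrightarrow> det_protocol n (bind_protocol p k)"
  by (induction p) auto

text \<open>\<open>m\<close> stays the total number of votes while the list shrinks, and
  \<open>c\<close> counts the answers \<open>True\<close> so far; a tie yields
  \<open>False\<close>.\<close>

primrec vote :: "nat \<Rightarrow> protocol list \<Rightarrow> nat \<Rightarrow> protocol" where
  "vote m [] c = Answer (m < 2 * c)"
| "vote m (p # ps) c = bind_protocol p (\<lambda>b. vote m ps (if b then Suc c else c))"

lemma run_vote: "run (vote m ps c) u H \<longleftrightarrow> m < 2 * (c + (\<Sum>p\<leftarrow>ps. of_bool (run p u H)))"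
  by (induction ps arbitrary: c) auto

lemma depth_vote: "(\<And>p. p \<in> set ps \<Longrightarrow> depth p \<le> d) \<Longrightarrow> depth (vote m ps c) \<le> length ps * d"
proof (induction ps arbitrary: c)
  case (Cons p ps)
  then have "depth (vote m (p # ps) c) \<le> depth p + length ps * d"
    by (simp add: depth_bind_protocol)
  then show ?case using Cons.prems[of p] by simp
qed simp

lemma det_protocol_vote: "(\<And>p. p \<in> set ps \<Longrightarrow> det_protocol n p) \<Longrightarrow> det_protocol n (vote m ps c)"
  by (induction ps arbitrary: c) (auto intro: det_protocol_bind)

definition majority :: "nat \<Rightarrow> (nat \<Rightarrow> protocol) \<Rightarrow> protocol" where
  "majority k \<omega> = vote k (map \<omega> [0..<k]) 0"

lemma run_majority: "run (majority k \<omega>) u H \<longleftrightarrow> real k < 2 * (\<Sum>i<k. of_bool (run (\<omega> i) u H))"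
proof -
  have "run (majority k \<omega>) u H \<longleftrightarrow> k < 2 * (\<Sum>i<k. of_bool (run (\<omega> i) u H))"
    by (simp add: majority_def run_vote interv_sum_list_conv_sum_set_nat comp_def atLeast0LessThan)
  also have "\<dots> \<longleftrightarrow> real k < real (2 * (\<Sum>i<k. of_bool (run (\<omega> i) u H)))" by (simp only: of_nat_less_iff)
  finally show ?thesis by simp
qed

lemma depth_majority: "(\<And>i. i < k \<Longrightarrow> depth (\<omega> i) \<le> d) \<Longrightarrow> depth (majority k \<omega>) \<le> k * d"
  unfolding majority_def by (rule order_trans[OF depth_vote[of _ d]]) auto

lemma det_protocol_majority: "(\<And>i. i < k \<Longrightarrow> det_protocol n (\<omega> i)) \<Longrightarrow> det_protocol n (majority k \<omega>)"
  unfolding majority_def by (intro det_protocol_vote) auto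

section \<open>Concentration of the vote\<close>

text \<open>Restriction to \<open>I\<close> is the identity on the product space, so the joint law
  of the coordinates is the product measure, which is the product of its marginals.\<close>

lemma (in prob_space) indep_vars_PiM_coord:
  assumes "I \<noteq> {}"
  shows "prob_space.indep_vars (PiM I (\<lambda>_. M)) (\<lambda>_. M) (\<lambda>i \<omega>. \<omega> i) I"
proof -
  interpret P: prob_space "PiM I (\<lambda>_. M)" by (intro prob_space_PiM prob_space_axioms)
  have "distr (PiM I (\<lambda>_. M)) (PiM I (\<lambda>_. M)) (\<lambda>\<omega>. restrict \<omega> I) = distr (PiM I (\<lambda>_. M)) (PiM I (\<lambda>_. M)) (\<lambda>\<omega>. \<omega>)"
    by (rule distr_cong) (auto simp: space_PiM PiE_restrict)
  also have "\<dots> = PiM I (\<lambda>_. M)" by (rule distr_id)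
  also have "\<dots> = PiM I (\<lambda>i. distr (PiM I (\<lambda>_. M)) M (\<lambda>\<omega>. \<omega> i))"
    by (intro PiM_cong refl distr_PiM_component[symmetric] prob_space_axioms)
  finally show ?thesis
    using assms by (subst P.indep_vars_iff_distr_eq_PiM') auto
qed

text \<open>Hoeffding for \<open>k\<close> independent variables in [0,1]: the expected sum is at
  most \<open>k * \<epsilon>\<close>, so half of the votes being bad is a deviation of at least
  \<open>k * (1/2 - \<epsilon>)\<close>. Ties count as bad, which covers both kinds of wrong
  majority.\<close>

lemma majority_error:
  assumes P: "prob_space P" and k: "k > 0"
    and W: "W \<in> measurable P (count_space UNIV)" "measure P {p \<in> space P. W p} \<le> \<epsilon>"
    and \<epsilon>: "\<epsilon> \<le> 1 / 2"
  shows "measure (PiM {..<k} (\<lambda>_. P)) {\<omega> \<in> space (PiM {..<k} (\<lambda>_. P)). real k \<le> 2 * (\<Sum>i<k. of_bool (W (\<omega> i)))}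
    \<le> exp (- 2 * real k * (1 / 2 - \<epsilon>)\<^sup>2)"
proof -
  interpret P: prob_space P by fact
  let ?M = "PiM {..<k} (\<lambda>_. P)"
  interpret M: prob_space ?M by (intro prob_space_PiM P)
  define X :: "nat \<Rightarrow> (nat \<Rightarrow> 'a) \<Rightarrow> real" where "X i \<omega> = of_bool (W (\<omega> i))" for i \<omega>
  have Wm: "(\<lambda>p. of_bool (W p) :: real) \<in> borel_measurable P"
    by (rule measurable_compose[OF W(1)]) simp
  have indep: "M.indep_vars (\<lambda>_. borel) X {..<k}"
    unfolding X_def[abs_def] using k Wm by (intro M.indep_vars_compose2[OF P.indep_vars_PiM_coord]) auto
  then interpret Hoeffding_ineq ?M "{..<k}" X "\<lambda>_. 0" "\<lambda>_. 1" "\<Sum>i<k. M.expectation (X i)"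
    by unfold_locales (auto simp: X_def indep)
  have "M.expectation (X i) \<le> \<epsilon>" if "i < k" for i
  proof -
    have "M.expectation (X i) = (\<integral>p. of_bool (W p) \<partial>distr ?M P (\<lambda>\<omega>. \<omega> i))"
      unfolding X_def[abs_def] using that Wm by (subst integral_distr) auto
    also have "distr ?M P (\<lambda>\<omega>. \<omega> i) = P"
      using that by (intro distr_PiM_component) (auto intro: P)
    also have "(\<integral>p. of_bool (W p) \<partial>P) = (\<integral>p. indicator {p \<in> space P. W p} p \<partial>P)"
      by (intro Bochner_Integration.integral_cong) auto
    also have "\<dots> = measure P {p \<in> space P. W p}" by (simp add: Int_def conj_ac cong: conj_cong)
    finally show ?thesis using W by simp
  qed
  then have "(\<Sum>i<k. M.expectation (X i)) \<le> (\<Sum>i<k. \<epsilon>)" by (intro sum_mono) auto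
  then have \<mu>: "(\<Sum>i<k. M.expectation (X i)) \<le> real k * \<epsilon>" by simp
  have "M.prob {\<omega> \<in> space ?M. real k \<le> 2 * (\<Sum>i<k. of_bool (W (\<omega> i)))}
      \<le> M.prob {\<omega> \<in> space ?M. (\<Sum>i<k. X i \<omega>) \<ge> (\<Sum>i<k. M.expectation (X i)) + real k * (1 / 2 - \<epsilon>)}"
  proof (rule M.finite_measure_mono)
    show "{\<omega> \<in> space ?M. (\<Sum>i<k. X i \<omega>) \<ge> (\<Sum>i<k. M.expectation (X i)) + real k * (1 / 2 - \<epsilon>)} \<in> M.events"
      by measurable
  qed (use \<mu> in \<open>auto simp: X_def algebra_simps\<close>)
  also have "\<dots> \<le> exp (- 2 * (real k * (1 / 2 - \<epsilon>))\<^sup>2 / (\<Sum>i<k. (1 - 0)\<^sup>2))"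
    using \<epsilon> k by (intro Hoeffding_ineq_ge) auto
  also have "- 2 * (real k * (1 / 2 - \<epsilon>))\<^sup>2 / (\<Sum>i<k. (1 - 0)\<^sup>2) = - 2 * real k * (1 / 2 - \<epsilon>)\<^sup>2"
    using k by (simp add: power2_eq_square)
  finally show ?thesis .
qed

section \<open>The lower bound\<close>

lemma nn_integral_of_bool:
  assumes "{x \<in> space M. P x} \<in> sets M"
  shows "(\<integral>\<^sup>+x. of_bool (P x) \<partial>M) = emeasure M {x \<in> space M. P x}"
proof -
  have "(\<integral>\<^sup>+x. of_bool (P x) \<partial>M) = (\<integral>\<^sup>+x. indicator {x \<in> space M. P x} x \<partial>M)"
    by (rule nn_integral_cong) simp
  then show ?thesis using assms by simp
qed

text \<open>Tonelli twice: the average over \<open>\<omega>\<close> moves inside the one over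
  \<open>h\<close>, then inside the one over \<open>u\<close>, where the pointwise bound applies.
  The bound is demanded only almost everywhere in \<open>u\<close>, since the promise holds only
  almost surely under \<open>K h\<close>. \<open>Q\<close> stands for either kind of error.\<close>

lemma averaged_error:
  assumes M: "prob_space M" and g: "prob_space g"
    and K: "K \<in> measurable g (subprob_algebra S)" and pK: "\<And>h. h \<in> space g \<Longrightarrow> prob_space (K h)"
    and Q[measurable]: "Measurable.pred ((M \<Otimes>\<^sub>M g) \<Otimes>\<^sub>M S) (\<lambda>w. Q (fst (fst w)) (snd (fst w)) (snd w))"
    and bound: "\<And>h. h \<in> space g \<Longrightarrow> AE u in K h. measure M {\<omega> \<in> space M. Q \<omega> h u} \<le> \<delta>"
  shows measurable_averaged_error:
      "(\<lambda>z. emeasure (K (snd z)) {u \<in> space S. Q (fst z) (snd z) u}) \<in> borel_measurable (M \<Otimes>\<^sub>M g)"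
    and averaged_error_le:
      "(\<integral>\<^sup>+\<omega>. \<integral>\<^sup>+h. emeasure (K h) {u \<in> space S. Q \<omega> h u} \<partial>g \<partial>M) \<le> ennreal \<delta>"
proof -
  interpret M: prob_space M by fact
  interpret g: prob_space g by fact
  interpret Mg: pair_sigma_finite M g ..
  show meas: "(\<lambda>z. emeasure (K (snd z)) {u \<in> space S. Q (fst z) (snd z) u}) \<in> borel_measurable (M \<Otimes>\<^sub>M g)"
  proof (rule emeasure_measurable_subprob_algebra2)
    have "(SIGMA z:space (M \<Otimes>\<^sub>M g). {u \<in> space S. Q (fst z) (snd z) u})
        = {w \<in> space ((M \<Otimes>\<^sub>M g) \<Otimes>\<^sub>M S). Q (fst (fst w)) (snd (fst w)) (snd w)}"
      by (auto simp: space_pair_measure)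
    also have "\<dots> \<in> sets ((M \<Otimes>\<^sub>M g) \<Otimes>\<^sub>M S)" by measurable
    finally show "(SIGMA z:space (M \<Otimes>\<^sub>M g). {u \<in> space S. Q (fst z) (snd z) u}) \<in> sets ((M \<Otimes>\<^sub>M g) \<Otimes>\<^sub>M S)" .
    show "(\<lambda>z. K (snd z)) \<in> measurable (M \<Otimes>\<^sub>M g) (subprob_algebra S)"
      by (rule measurable_compose[OF measurable_snd K])
  qed
  have "(\<integral>\<^sup>+\<omega>. \<integral>\<^sup>+h. emeasure (K h) {u \<in> space S. Q \<omega> h u} \<partial>g \<partial>M)
      = (\<integral>\<^sup>+h. \<integral>\<^sup>+\<omega>. emeasure (K h) {u \<in> space S. Q \<omega> h u} \<partial>M \<partial>g)"
    using meas by (intro Mg.Fubini'[symmetric]) (simp add: case_prod_beta)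
  also have "\<dots> \<le> (\<integral>\<^sup>+h. ennreal \<delta> \<partial>g)"
  proof (rule nn_integral_mono)
    fix h assume h: "h \<in> space g"
    interpret K: prob_space "K h" by (rule pK[OF h])
    interpret MK: pair_sigma_finite M "K h" ..
    have sK: "sets (K h) = sets S" "space (K h) = space S"
      using subprob_measurableD[OF K h] by auto
    have "(\<lambda>z. ((fst z, h), snd z)) \<in> measurable (M \<Otimes>\<^sub>M S) ((M \<Otimes>\<^sub>M g) \<Otimes>\<^sub>M S)"
      using h by (intro measurable_Pair measurable_compose[OF measurable_fst] measurable_const) auto
    from measurable_compose[OF this Q]
    have "Measurable.pred (M \<Otimes>\<^sub>M S) (\<lambda>z. Q (fst z) h (snd z))" by simp
    then have Qh[measurable]: "Measurable.pred (M \<Otimes>\<^sub>M K h) (\<lambda>z. Q (fst z) h (snd z))"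
      using measurable_cong_sets[OF sets_pair_measure_cong[OF refl sK(1)] refl] by blast
    have sets_u: "{u \<in> space S. Q \<omega> h u} \<in> sets (K h)" if "\<omega> \<in> space M" for \<omega>
    proof -
      have "Measurable.pred (K h) (\<lambda>u. Q \<omega> h u)"
        using measurable_compose[OF measurable_Pair1'[OF that] Qh] by simp
      then show ?thesis unfolding sK(2)[symmetric] by measurable
    qed
    have sets_\<omega>: "{\<omega> \<in> space M. Q \<omega> h u} \<in> sets M" if "u \<in> space (K h)" for u
    proof -
      have "Measurable.pred M (\<lambda>\<omega>. Q \<omega> h u)"
        using measurable_compose[OF measurable_Pair2'[OF that] Qh] by simp
      then show ?thesis by measurable
    qed
    have "(\<integral>\<^sup>+\<omega>. emeasure (K h) {u \<in> space S. Q \<omega> h u} \<partial>M) = (\<integral>\<^sup>+\<omega>. \<integral>\<^sup>+u. of_bool (Q \<omega> h u) \<partial>K h \<partial>M)"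
      unfolding sK(2)[symmetric]
      by (rule nn_integral_cong, rule nn_integral_of_bool[symmetric]) (use sets_u in \<open>simp add: sK(2)\<close>)
    also have "\<dots> = (\<integral>\<^sup>+u. \<integral>\<^sup>+\<omega>. of_bool (Q \<omega> h u) \<partial>M \<partial>K h)"
      by (intro MK.Fubini'[symmetric]) (simp add: case_prod_beta)
    also have "\<dots> = (\<integral>\<^sup>+u. emeasure M {\<omega> \<in> space M. Q \<omega> h u} \<partial>K h)"
      by (rule nn_integral_cong, rule nn_integral_of_bool, rule sets_\<omega>)
    also have "\<dots> \<le> (\<integral>\<^sup>+u. ennreal \<delta> \<partial>K h)"
      using bound[OF h]
      by (intro nn_integral_mono_AE, eventually_elim) (simp add: M.emeasure_eq_measure ennreal_leI)
    also have "\<dots> = ennreal \<delta>" by (simp add: K.emeasure_space_1)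
    finally show "(\<integral>\<^sup>+\<omega>. emeasure (K h) {u \<in> space S. Q \<omega> h u} \<partial>M) \<le> ennreal \<delta>" .
  qed
  also have "\<dots> = ennreal \<delta>" by (simp add: g.emeasure_space_1)
  finally show "(\<integral>\<^sup>+\<omega>. \<integral>\<^sup>+h. emeasure (K h) {u \<in> space S. Q \<omega> h u} \<partial>g \<partial>M) \<le> ennreal \<delta>" .
qed

text \<open>Joint measurability of a single run passes to each coordinate of a tuple of runs, and
  the majority compares a finite sum of these with \<open>k\<close>.\<close>

lemma measurable_run_majority:
  assumes "(\<lambda>(p, u, H). run p u H) \<in> measurable (P \<Otimes>\<^sub>M (S \<Otimes>\<^sub>M G)) (count_space UNIV)"
  shows "Measurable.pred ((PiM {..<k} (\<lambda>_. P) \<Otimes>\<^sub>M G) \<Otimes>\<^sub>M S) (\<lambda>w. run (majority k (fst (fst w))) (snd w) (snd (fst w)))"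
proof -
  let ?X = "(PiM {..<k} (\<lambda>_. P) \<Otimes>\<^sub>M G) \<Otimes>\<^sub>M S"
  have "Measurable.pred ?X (\<lambda>w. run (fst (fst w) i) (snd w) (snd (fst w)))" if "i < k" for i
  proof -
    have "(\<lambda>w. (fst (fst w) i, snd w, snd (fst w))) \<in> measurable ?X (P \<Otimes>\<^sub>M (S \<Otimes>\<^sub>M G))"
      using that
      by (intro measurable_Pair measurable_snd measurable_compose[OF measurable_fst]
          measurable_compose[OF measurable_fst measurable_component_singleton]) auto
    from measurable_compose[OF this assms] show ?thesis by simp
  qed
  then have "(\<lambda>w. of_bool (run (fst (fst w) i) (snd w) (snd (fst w))) :: real) \<in> borel_measurable ?X" if "i < k" for i
    using that by (intro measurable_compose[OF _ borel_measurable_count_space]) auto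
  then have "(\<lambda>w. 2 * (\<Sum>i<k. of_bool (run (fst (fst w) i) (snd w) (snd (fst w)))) :: real) \<in> borel_measurable ?X"
    by (intro borel_measurable_times borel_measurable_sum borel_measurable_const) auto
  then show ?thesis unfolding run_majority by measurable
qed

lemma sum_of_bool_not:
  "(\<Sum>i<k. of_bool (\<not> A i)) = real k - (\<Sum>i<k. of_bool (A i))"
  by (simp only: of_bool_not_iff sum_subtractf) simp

lemma majority_protocol_error:
  assumes P: "rand_protocol n P" "error_at_most n P \<epsilon>" "VSP_promise n u H"
    and k: "k > 0" and \<epsilon>: "\<epsilon> \<le> 1 / 2"
    and R: "Measurable.pred P (\<lambda>p. run p u H)"
  shows "measure (PiM {..<k} (\<lambda>_. P)) {\<omega> \<in> space (PiM {..<k} (\<lambda>_. P)). run (majority k \<omega>) u H \<noteq> (u \<in> H)}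
    \<le> exp (- 2 * real k * (1 / 2 - \<epsilon>)\<^sup>2)"
proof -
  let ?M = "PiM {..<k} (\<lambda>_. P)"
  let ?W = "\<lambda>p. run p u H \<noteq> (u \<in> H)"
  have pP: "prob_space P" using P by (simp add: rand_protocol_def)
  interpret M: prob_space ?M by (intro prob_space_PiM pP)
  have W[measurable]: "Measurable.pred P ?W" using R by measurable
  \<comment> \<open>For \<open>u \<in> H\<close> a wrong majority means that at most half of the
    runs say \<open>True\<close>, otherwise that more than half do; either way at least half of the
    runs err.\<close>
  have "{\<omega> \<in> space ?M. run (majority k \<omega>) u H \<noteq> (u \<in> H)}
      \<subseteq> {\<omega> \<in> space ?M. real k \<le> 2 * (\<Sum>i<k. of_bool (?W (\<omega> i)))}"
  proof
    fix \<omega> assume \<omega>: "\<omega> \<in> {\<omega> \<in> space ?M. run (majority k \<omega>) u H \<noteq> (u \<in> H)}"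
    then have "run (majority k \<omega>) u H \<noteq> (u \<in> H)" by simp
    then have "real k \<le> 2 * (\<Sum>i<k. of_bool (?W (\<omega> i)))"
      unfolding run_majority
      by (cases "u \<in> H") (simp_all add: sum_of_bool_not del: sum_of_bool_eq)
    with \<omega> show "\<omega> \<in> {\<omega> \<in> space ?M. real k \<le> 2 * (\<Sum>i<k. of_bool (?W (\<omega> i)))}" by blast
  qed
  then have "M.prob {\<omega> \<in> space ?M. run (majority k \<omega>) u H \<noteq> (u \<in> H)}
      \<le> M.prob {\<omega> \<in> space ?M. real k \<le> 2 * (\<Sum>i<k. of_bool (?W (\<omega> i)))}"
  proof (rule M.finite_measure_mono)
    have Wb: "(\<lambda>p. of_bool (?W p) :: real) \<in> borel_measurable P"
      by (rule measurable_compose[OF W]) simp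
    have "(\<lambda>\<omega>. of_bool (?W (\<omega> i)) :: real) \<in> borel_measurable ?M" if "i < k" for i
      using measurable_compose[OF measurable_component_singleton[of i "{..<k}" "\<lambda>_. P"] Wb] that by simp
    then have [measurable]: "(\<lambda>\<omega>. 2 * (\<Sum>i<k. of_bool (?W (\<omega> i))) :: real) \<in> borel_measurable ?M"
      by (intro borel_measurable_times borel_measurable_sum borel_measurable_const) auto
    show "{\<omega> \<in> space ?M. real k \<le> 2 * (\<Sum>i<k. of_bool (?W (\<omega> i)))} \<in> M.events" by measurable
  qed
  also have "\<dots> \<le> exp (- 2 * real k * (1 / 2 - \<epsilon>)\<^sup>2)"
    using P(2,3) by (intro majority_error[OF pP k W _ \<epsilon>]) (simp add: error_at_most_def)
  finally show ?thesis .
qed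

text \<open>The two averaged errors of the majority protocol are at most 1/10 each, whereas for each
  of its deterministic realisations, of depth at most \<open>k * D\<close>, their sum is at least
  6/25, which exceeds 1/5.\<close>

lemma VSP_no_short_protocol:
  fixes \<sigma> :: "fvec set \<Rightarrow> fvec measure" and g :: "fvec set measure"
  assumes sigma: "\<And>H. subspace H \<Longrightarrow> H \<subseteq> Rn n \<Longrightarrow> H \<noteq> {0} \<Longrightarrow> haar_usphere H (\<sigma> H)"
    and g: "haar_Gr n (n div 2) g" and n: "n \<ge> 2"
    and sampling: "\<And>A. A \<in> sets (usphere_borel (Rn n)) \<Longrightarrow> measure (\<sigma> (Rn n)) A \<ge> \<tau> \<Longrightarrow>
         measure g {H \<in> space g.
             sqrt (measure (\<sigma> H) (A \<inter> H) * measure (\<sigma> (perp n H)) (A \<inter> perp n H))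
               \<ge> 0.9 * measure (\<sigma> (Rn n)) A} \<ge> 1 - \<eta>"
    and P: "rand_protocol n P" "error_at_most n P \<epsilon>"
    and D: "\<And>p. p \<in> space P \<Longrightarrow> depth p \<le> D"
    and k: "k > 0" "exp (- 2 * real k * (1 / 2 - \<epsilon>)\<^sup>2) \<le> 1 / 10" and \<epsilon>: "\<epsilon> \<le> 1 / 2"
    and \<tau>: "\<tau> \<ge> 0" "2 ^ (k * D) * \<tau> \<le> 1 / 9"
    and \<eta>: "\<eta> \<ge> 0" "2 ^ (k * D) * \<eta> \<le> 1 / 4"
  shows False
proof -
  let ?S = "usphere_borel (Rn n)"
  let ?G = "Gr_borel n (n div 2)"
  let ?M = "PiM {..<k} (\<lambda>_. P)"
  have pg: "prob_space g" and sg: "sets g = sets ?G" using g by (auto simp: haar_Gr_def)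
  have spg: "space g = Gr n (n div 2)" using sets_eq_imp_space_eq[OF sg] by (simp add: Gr_borel_def)
  have pP: "prob_space P" using P by (simp add: rand_protocol_def)
  interpret M: prob_space ?M by (intro prob_space_PiM pP)
  have n': "0 < n div 2" "n div 2 < n" using n by auto
  note Gr = Gr_nontrivial[OF _ n', folded spg]
  \<comment> \<open>The Grassmannian is nonempty because it carries the probability measure
    \<open>g\<close>, and any member is a nonzero subspace of \<open>Rn n\<close>.\<close>
  have "Rn n \<noteq> {0}" using n' Gr_nontrivial(2,3)[OF _ n'] prob_space.not_empty[OF pg] spg
      subspace_0[OF Gr(1)] by fastforce
  then have s: "reflection_invariant (Rn n) (\<sigma> (Rn n))"
    by (intro haar_usphere_reflection_invariant sigma subspace_Rn subset_refl)
  then have ss: "prob_space (\<sigma> (Rn n))" "sets (\<sigma> (Rn n)) = sets ?S"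
    by (auto simp: reflection_invariant_def)
  have r0: "reflection_invariant H (\<sigma> H)" and r1: "reflection_invariant (perp n H) (\<sigma> (perp n H))"
    if "H \<in> space g" for H
    using Gr[OF that] by (auto intro!: haar_usphere_reflection_invariant sigma)
  define x where "x H = sphere_kernel n (\<sigma> H)" for H
  define y where "y H = sphere_kernel n (\<sigma> (perp n H))" for H
  have x: "x \<in> measurable g (subprob_algebra ?S)" unfolding x_def
    using Gr(1,2) r0 measurable_orth_proj_Gr[of n "n div 2"] sg
    by (intro measurable_sphere_kernel[OF _ s]) (auto cong: measurable_cong_sets sets_pair_measure_cong)
  have y: "y \<in> measurable g (subprob_algebra ?S)" unfolding y_def
    using Gr(4,5) r1 measurable_orth_proj_perp_Gr[of n "n div 2"] sg
    by (intro measurable_sphere_kernel[OF _ s]) (auto cong: measurable_cong_sets sets_pair_measure_cong)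
  have px: "prob_space (x H)" and py: "prob_space (y H)" if "H \<in> space g" for H
    unfolding x_def y_def using Gr[OF that] r0[OF that] r1[OF that] by (auto intro: prob_space_sphere_kernel)
  have xy: "measure (x H) A = measure (\<sigma> H) (A \<inter> H)" "measure (y H) A = measure (\<sigma> (perp n H)) (A \<inter> perp n H)"
    if "H \<in> space g" "A \<in> sets ?S" for H A
    unfolding x_def y_def measure_def using that Gr[OF that(1)] r0[OF that(1)] r1[OF that(1)]
    by (auto simp: emeasure_sphere_kernel)
  have run: "(\<lambda>(p, u, H). run p u H) \<in> measurable (P \<Otimes>\<^sub>M (?S \<Otimes>\<^sub>M g)) (count_space UNIV)"
    using P(1) unfolding rand_protocol_def
    by (subst measurable_cong_sets[OF sets_pair_measure_cong[OF refl sets_pair_measure_cong[OF refl sg]] refl]) blast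
  have run1: "Measurable.pred P (\<lambda>p. run p u H)" if "u \<in> usphere (Rn n)" "H \<in> space g" for u H
  proof -
    have "(\<lambda>p. (p, u, H)) \<in> measurable P (P \<Otimes>\<^sub>M (?S \<Otimes>\<^sub>M g))"
      using that by (intro measurable_Pair2') (simp add: space_pair_measure space_usphere_borel)
    from measurable_compose[OF this run] show ?thesis by simp
  qed
  note R = measurable_run_majority[OF run, of k]
  note R' = pred_intros_logic(2)[OF R]
  \<comment> \<open>\<open>e0\<close> is the error mass on the sphere of \<open>H\<close>, where the
    answer should be \<open>True\<close>; \<open>e1\<close> is the one on the sphere of the
    complement.\<close>
  define e0 where "e0 \<omega> H = emeasure (x H) {u \<in> space ?S. \<not> run (majority k \<omega>) u H}" for \<omega> H
  define e1 where "e1 \<omega> H = emeasure (y H) {u \<in> space ?S. run (majority k \<omega>) u H}" for \<omega> H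
  have b0: "AE u in x H. measure ?M {\<omega> \<in> space ?M. \<not> run (majority k \<omega>) u H} \<le> 1 / 10" if H: "H \<in> space g" for H
  proof -
    have "AE u in x H. u \<in> usphere H" unfolding x_def
      by (rule AE_sphere_kernel[OF Gr(1,2)[OF H] r0[OF H]])
    then show ?thesis
    proof eventually_elim
      case (elim u)
      then have u: "u \<in> usphere (Rn n)" "u \<in> H" using Gr(2)[OF H] by (auto simp: usphere_def)
      then have "VSP_promise n u H" using H by (simp add: VSP_promise_def spg)
      from majority_protocol_error[OF P this k(1) \<epsilon> run1[OF u(1) H]] show ?case using u k(2) by simp
    qed
  qed
  have b1: "AE u in y H. measure ?M {\<omega> \<in> space ?M. run (majority k \<omega>) u H} \<le> 1 / 10" if H: "H \<in> space g" for H
  proof -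
    have "AE u in y H. u \<in> usphere (perp n H)" unfolding y_def
      by (rule AE_sphere_kernel[OF Gr(4,5)[OF H] r1[OF H]])
    then show ?thesis
    proof eventually_elim
      case (elim u)
      then have u: "u \<in> usphere (Rn n)" "u \<in> perp n H" using Gr(5)[OF H] by (auto simp: usphere_def)
      \<comment> \<open>A unit vector of the complement is outside \<open>H\<close>, so the answer
        \<open>True\<close> is the error measured here.\<close>
      have "u \<notin> H"
      proof
        assume "u \<in> H"
        then have "inner u u = 0" using u(2) by (auto simp: perp_def orthogonal_def)
        then show False using u(1) by (simp add: usphere_def)
      qed
      moreover have "VSP_promise n u H" using H u by (simp add: VSP_promise_def spg)
      ultimately show ?case using majority_protocol_error[OF P _ k(1) \<epsilon> run1[OF u(1) H]] k(2) by simp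
    qed
  qed
  note E0 = averaged_error[OF M.prob_space_axioms pg x px R' b0, folded e0_def]
  note E1 = averaged_error[OF M.prob_space_axioms pg y py R b1, folded e1_def]
  have inner_meas: "(\<lambda>H. e0 \<omega> H) \<in> borel_measurable g" "(\<lambda>H. e1 \<omega> H) \<in> borel_measurable g"
    if "\<omega> \<in> space ?M" for \<omega>
    using measurable_compose[OF measurable_Pair1'[OF that] E0(1)] measurable_compose[OF measurable_Pair1'[OF that] E1(1)]
    by simp_all
  interpret g: prob_space g by fact
  have outer_meas: "(\<lambda>\<omega>. \<integral>\<^sup>+H. e0 \<omega> H \<partial>g) \<in> borel_measurable ?M" "(\<lambda>\<omega>. \<integral>\<^sup>+H. e1 \<omega> H \<partial>g) \<in> borel_measurable ?M"
    using g.borel_measurable_nn_integral_fst[OF E0(1)] g.borel_measurable_nn_integral_fst[OF E1(1)] by simp_all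
  have "ennreal (6 / 25) = (\<integral>\<^sup>+\<omega>. ennreal (6 / 25) \<partial>?M)" by (simp add: M.emeasure_space_1)
  also have "\<dots> \<le> (\<integral>\<^sup>+\<omega>. \<integral>\<^sup>+H. e0 \<omega> H + e1 \<omega> H \<partial>g \<partial>?M)"
  proof (rule nn_integral_mono)
    fix \<omega> assume "\<omega> \<in> space ?M"
    then have \<omega>: "\<omega> i \<in> space P" if "i < k" for i using that by (auto simp: space_PiM)
    have d: "depth (majority k \<omega>) \<le> k * D" using D[OF \<omega>] by (rule depth_majority)
    have det: "det_protocol n (majority k \<omega>)"
      using \<omega> P(1) by (intro det_protocol_majority) (auto simp: rand_protocol_def)
    have pow: "(2::real) ^ depth (majority k \<omega>) * c \<le> 2 ^ (k * D) * c" if "c \<ge> 0" for c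
      using that d by (intro mult_right_mono power_increasing) auto
    show "ennreal (6 / 25) \<le> (\<integral>\<^sup>+H. e0 \<omega> H + e1 \<omega> H \<partial>g)"
      unfolding e0_def e1_def space_usphere_borel
    proof (rule error_lower_bound_average[OF ss pg x px y py \<tau>(1) _ \<eta>(1) _ det])
      show "2 ^ depth (majority k \<omega>) * \<tau> \<le> 1 / 9" "2 ^ depth (majority k \<omega>) * \<eta> \<le> 1 / 4"
        using pow[OF \<tau>(1)] \<tau>(2) pow[OF \<eta>(1)] \<eta>(2) by auto
      fix A assume A: "A \<in> sets ?S" "\<tau> \<le> measure (\<sigma> (Rn n)) A"
      have "{H \<in> space g. sqrt (measure (x H) A * measure (y H) A) \<ge> 0.9 * measure (\<sigma> (Rn n)) A}
          = {H \<in> space g. sqrt (measure (\<sigma> H) (A \<inter> H) * measure (\<sigma> (perp n H)) (A \<inter> perp n H))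
               \<ge> 0.9 * measure (\<sigma> (Rn n)) A}"
        using xy[OF _ A(1)] by auto
      then show "1 - \<eta> \<le> measure g {H \<in> space g. sqrt (measure (x H) A * measure (y H) A) \<ge> 0.9 * measure (\<sigma> (Rn n)) A}"
        using sampling[OF A] by simp
    qed
  qed
  also have "\<dots> = (\<integral>\<^sup>+\<omega>. (\<integral>\<^sup>+H. e0 \<omega> H \<partial>g) + (\<integral>\<^sup>+H. e1 \<omega> H \<partial>g) \<partial>?M)"
    by (intro nn_integral_cong nn_integral_add inner_meas)
  also have "\<dots> = (\<integral>\<^sup>+\<omega>. \<integral>\<^sup>+H. e0 \<omega> H \<partial>g \<partial>?M) + (\<integral>\<^sup>+\<omega>. \<integral>\<^sup>+H. e1 \<omega> H \<partial>g \<partial>?M)"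
    by (intro nn_integral_add outer_meas)
  also have "\<dots> \<le> ennreal (1 / 10) + ennreal (1 / 10)" by (intro add_mono E0(2) E1(2))
  also have "\<dots> = ennreal (1 / 5)" by (simp flip: ennreal_plus)
  finally show False by simp
qed

section \<open>Choice of the constants\<close>

theorem theorem1p4:
  fixes \<sigma> :: "fvec set \<Rightarrow> fvec measure" and \<gamma> :: "nat \<Rightarrow> fvec set measure"
  assumes sigma: "\<And>n H. subspace H \<Longrightarrow> H \<subseteq> Rn n \<Longrightarrow> H \<noteq> {0} \<Longrightarrow> haar_usphere H (\<sigma> H)"
    and gamma: "\<And>n. n \<ge> 2 \<Longrightarrow> haar_Gr n (n div 2) (\<gamma> n)"
    and sampling: "\<exists>C c c' :: real. C > 0 \<and> c > 0 \<and> c' > 0 \<and>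
      (\<forall>n\<ge>2. \<forall>A \<in> sets (usphere_borel (Rn n)).
         measure (\<sigma> (Rn n)) A \<ge> exp (- c * sqrt (real n)) \<longrightarrow>
         measure (\<gamma> n) {H \<in> space (\<gamma> n).
             sqrt (measure (\<sigma> H) (A \<inter> H) * measure (\<sigma> (perp n H)) (A \<inter> perp n H))
               \<ge> 0.9 * measure (\<sigma> (Rn n)) A}
           \<ge> 1 - C * exp (- c' * sqrt (real n)))"
  shows "\<forall>\<epsilon> :: real. 0 < \<epsilon> \<and> \<epsilon> < 1 / 2 \<longrightarrow>
    (\<exists>\<kappa> > 0. \<exists>n0 :: nat. \<forall>n \<ge> n0. \<forall>P. rand_protocol n P \<and> error_at_most n P \<epsilon> \<longrightarrow>
       comm_complexity P \<ge> ereal (\<kappa> * sqrt (real n)))"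
proof (intro allI impI)
  fix \<epsilon> :: real assume \<epsilon>: "0 < \<epsilon> \<and> \<epsilon> < 1 / 2"
  from sampling obtain C c c' :: real where C: "C > 0" "c > 0" "c' > 0"
    and sampling': "\<And>n A. n \<ge> 2 \<Longrightarrow> A \<in> sets (usphere_borel (Rn n)) \<Longrightarrow>
         measure (\<sigma> (Rn n)) A \<ge> exp (- c * sqrt (real n)) \<Longrightarrow>
         measure (\<gamma> n) {H \<in> space (\<gamma> n).
             sqrt (measure (\<sigma> H) (A \<inter> H) * measure (\<sigma> (perp n H)) (A \<inter> perp n H))
               \<ge> 0.9 * measure (\<sigma> (Rn n)) A}
           \<ge> 1 - C * exp (- c' * sqrt (real n))"
    by blast
  define \<delta> where "\<delta> = (1 / 2 - \<epsilon>)\<^sup>2"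
  have \<delta>: "\<delta> > 0" using \<epsilon> by (simp add: \<delta>_def)
  \<comment> \<open>With \<open>k * \<delta> \<ge> 5\<close>, the inequality
    \<open>1 + t \<le> exp t\<close> at \<open>t = 2 * k * \<delta> \<ge> 10\<close> brings the
    majority error down to at most 1/10.\<close>
  define k where "k = nat \<lceil>5 / \<delta>\<rceil>"
  have "5 / \<delta> \<le> real k" unfolding k_def by (rule real_nat_ceiling_ge)
  then have k5: "real k * \<delta> \<ge> 5" using \<delta> by (simp add: pos_divide_le_eq)
  have k: "k > 0" using k5 by (cases k) auto
  have expk: "exp (- 2 * real k * \<delta>) \<le> 1 / 10"
  proof -
    have "10 \<le> 1 + 2 * real k * \<delta>" using k5 by argo
    also have "\<dots> \<le> exp (2 * real k * \<delta>)" by (rule exp_ge_add_one_self)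
    finally have "inverse (exp (2 * real k * \<delta>)) \<le> inverse 10" by (intro le_imp_inverse_le) auto
    then show ?thesis by (simp flip: exp_minus)
  qed
  \<comment> \<open>Half of the smaller rate: \<open>2 ^ (k * D)\<close> is at most
    \<open>exp x\<close> for \<open>x = m * sqrt n\<close>, while the two exponentials of the
    sampling hypothesis are at most \<open>exp (- 2 * x)\<close>, so the products are at most
    \<open>exp (- x)\<close>.\<close>
  define m where "m = min c c' / 2"
  have m: "m > 0" "2 * m \<le> c" "2 * m \<le> c'" using C by (auto simp: m_def)
  \<comment> \<open>Dividing by \<open>k\<close> absorbs the factor by which voting lengthens the
    protocol.\<close>
  define \<kappa> where "\<kappa> = m / real k"
  have \<kappa>: "\<kappa> > 0" using m k by (simp add: \<kappa>_def)
  \<comment> \<open>Forces \<open>x \<ge> 9\<close> and \<open>x \<ge> 4 * C\<close>, so that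
    \<open>1 / (1 + x)\<close> is at most 1/9 and \<open>C / (1 + x)\<close> at most 1/4.\<close>
  define n0 where "n0 = max 2 (nat \<lceil>(max 9 (4 * C) / m)\<^sup>2\<rceil>)"
  show "\<exists>\<kappa> > 0. \<exists>n0 :: nat. \<forall>n \<ge> n0. \<forall>P. rand_protocol n P \<and> error_at_most n P \<epsilon> \<longrightarrow>
       comm_complexity P \<ge> ereal (\<kappa> * sqrt (real n))"
  proof (intro exI[of _ \<kappa>] conjI \<kappa> exI[of _ n0] allI impI)
    fix n P assume n0: "n0 \<le> n" and P: "rand_protocol n P \<and> error_at_most n P \<epsilon>"
    have n: "n \<ge> 2" using n0 by (simp add: n0_def)
    define x where "x = m * sqrt (real n)"
    have "(max 9 (4 * C) / m)\<^sup>2 \<le> real n"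
      using n0 real_nat_ceiling_ge[of "(max 9 (4 * C) / m)\<^sup>2"] unfolding n0_def
      by (meson max.boundedE of_nat_mono order_trans)
    then have "max 9 (4 * C) / m \<le> sqrt (real n)" by (rule real_le_rsqrt)
    then have "max 9 (4 * C) \<le> x" using m by (simp add: x_def field_simps)
    then have x: "9 \<le> x" "4 * C \<le> x" by auto
    have expx: "exp (- x) \<le> 1 / (1 + x)"
      using exp_ge_add_one_self[of x] x by (simp add: exp_minus field_simps)
    show "ereal (\<kappa> * sqrt (real n)) \<le> comm_complexity P"
    proof (rule ccontr)
      assume "\<not> ereal (\<kappa> * sqrt (real n)) \<le> comm_complexity P"
      then have less: "comm_complexity P < ereal (\<kappa> * sqrt (real n))" by simp
      \<comment> \<open>The supremum is now finite and bounds all depths; these are natural numbers,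
        so rounding down loses nothing.\<close>
      define D where "D = nat \<lfloor>\<kappa> * sqrt (real n)\<rfloor>"
      have D: "depth p \<le> D" if "p \<in> space P" for p
      proof -
        have "ereal (real (depth p)) \<le> comm_complexity P"
          unfolding comm_complexity_def using that by (rule SUP_upper)
        then have "ereal (real (depth p)) < ereal (\<kappa> * sqrt (real n))" using less by (rule le_less_trans)
        then show ?thesis by (simp add: D_def le_nat_floor)
      qed
      have "real D \<le> \<kappa> * sqrt (real n)" using \<kappa> by (simp add: D_def of_nat_floor)
      then have "real k * real D \<le> real k * (\<kappa> * sqrt (real n))" by (rule mult_left_mono) simp
      then have kD: "real (k * D) \<le> x" using k by (simp add: \<kappa>_def x_def)
      have "(2 :: real) ^ (k * D) \<le> exp 1 ^ (k * D)"
        using exp_ge_add_one_self[of 1] by (intro power_mono) auto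
      also have "\<dots> = exp (real (k * D))" by (simp flip: exp_of_nat_mult)
      also have "\<dots> \<le> exp x" using kD by simp
      finally have pow: "(2 :: real) ^ (k * D) \<le> exp x" .
      have small: "2 ^ (k * D) * exp (- a * sqrt (real n)) \<le> 1 / (1 + x)" if "2 * m \<le> a" for a
      proof -
        have "2 * m * sqrt (real n) \<le> a * sqrt (real n)" using that by (rule mult_right_mono) simp
        then have "2 ^ (k * D) * exp (- a * sqrt (real n)) \<le> exp x * exp (- 2 * x)"
          using pow by (intro mult_mono) (auto simp: x_def)
        also have "\<dots> = exp (- x)" by (simp flip: exp_add)
        finally show ?thesis using expx by simp
      qed
      show False
      \<comment> \<open>Unification with the sampling hypothesis sets
        \<open>\<tau> = exp (- c * sqrt n)\<close> and
        \<open>\<eta> = C * exp (- c' * sqrt n)\<close>.\<close>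
      proof (rule VSP_no_short_protocol[where n = n and P = P and D = D and k = k and \<epsilon> = \<epsilon>,
            OF sigma gamma[OF n] n sampling'[OF n]])
        show "2 ^ (k * D) * exp (- c * sqrt (real n)) \<le> 1 / 9"
          by (rule order_trans[OF small[OF m(2)]]) (use x(1) in \<open>simp add: field_simps\<close>)
        have "C * (2 ^ (k * D) * exp (- c' * sqrt (real n))) \<le> C * (1 / (1 + x))"
          using small[OF m(3)] C(1) by (intro mult_left_mono) auto
        also have "\<dots> \<le> 1 / 4" using x by (simp add: field_simps)
        finally show "2 ^ (k * D) * (C * exp (- c' * sqrt (real n))) \<le> 1 / 4"
          by (simp add: mult.left_commute)
      qed (use P D k expk \<epsilon> C in \<open>auto simp: \<delta>_def\<close>)
    qed
  qed
qed

end
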